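(* Let $(H_\Lambda)_{\Lambda\in\mathcal{B}(\mathbb{R}^d)}$ be an integrable family of energies (not assumed hereditary), with associated set $\mathcal{M}_\infty(\mathbb{R}^d)$ of locally finite energy configurations and local energy $h$. Let $\mu$ be a stationary Gibbs measure for $(H_\Lambda)$ and let $\mathcal{C}^!_\mu$ be its reduced Campbell measure. Then for every bounded non-negative measurable function $f:\mathbb{R}^d\times\mathcal{M}(\mathbb{R}^d)\to\mathbb{R}$, $$\int_{\mathbb{R}^d\times\mathcal{M}(\mathbb{R}^d)}\mathbf{1}_{\mathcal{M}_\infty(\mathbb{R}^d)}(\gamma)\,f(x,\gamma)\,\mathcal{C}^!_\mu(\mathrm{d}x,\mathrm{d}\gamma)=\int_{\mathbb{R}^d}\int_{\mathcal{M}(\mathbb{R}^d)}f(x,\gamma)\,e^{-h(x,\gamma)}\,\lambda(\mathrm{d}x)\,\mu(\mathrm{d}\gamma).$$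
   Context: Fix an integer $d$ greater than $1$. $\mathcal{B}(\mathbb{R}^d)$ is the set of bounded Borel subsets of $\mathbb{R}^d$ and $\lambda$ is Lebesgue measure. $\mathcal{M}(\mathbb{R}^d)$ is the set of simple integer-valued measures $\gamma$ on $\mathbb{R}^d$ (i.e. $\gamma(\Lambda)\in\mathbb{N}$ for $\Lambda\in\mathcal{B}(\mathbb{R}^d)$ and $\gamma(\{x\})\le 1$ for all $x$), with the $\sigma$-algebra generated by the sets $\{\gamma:\gamma(\Lambda)=n\}$, $n\in\mathbb{N}$, $\Lambda\in\mathcal{B}(\mathbb{R}^d)$. Write $x\in\gamma$ if $\gamma(\{x\})>0$; $\gamma_\Lambda=\sum_{x\in\gamma\cap\Lambda}\delta_x$. $\pi_\Lambda$ is the Poisson process on $\Lambda$ with intensity $\mathbf{1}_\Lambda\lambda$. Family of energies: measurable functions $H_\Lambda:\mathcal{M}(\mathbb{R}^d)\to\mathbb{R}\cup\{+\infty\}$, $\Lambda\in\mathcal{B}(\mathbb{R}^d)$, such that for all $\Lambda\subset\Lambda'$ in $\mathcal{B}(\mathbb{R}^d)$ there is a measurable $\varphi_{\Lambda,\Lambda'}:\mathcal{M}(\mathbb{R}^d)\to\mathbb{R}\cup\{+\infty\}$ with $H_{\Lambda'}(\gamma)=H_\Lambda(\gamma)+\varphi_{\Lambda,\Lambda'}(\gamma_{\Lambda^c})$ for all $\gamma\in\mathcal{M}(\mathbb{R}^d)$. It is called hereditary if $H_\Lambda(\gamma)=+\infty$ implies $H_\Lambda(\gamma+\delta_x)=+\infty$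 for all $\Lambda,\gamma$ and $x\in\Lambda$; this is not assumed. $\mathcal{M}_\infty(\mathbb{R}^d)$ is the set of $\gamma\in\mathcal{M}(\mathbb{R}^d)$ with $H_\Lambda(\gamma)<+\infty$ for all $\Lambda\in\mathcal{B}(\mathbb{R}^d)$. A point $x\in\gamma$ is removable from $\gamma$ if there is $\Lambda\in\mathcal{B}(\mathbb{R}^d)$ with $x\in\Lambda$ and $H_\Lambda(\gamma-\delta_x)<+\infty$; then the local energy is $h(x,\gamma-\delta_x)=H_\Lambda(\gamma)-H_\Lambda(\gamma-\delta_x)\in\mathbb{R}\cup\{+\infty\}$ for any such $\Lambda$ (the value does not depend on the choice). In particular $h(x,\gamma)$ is defined for every $\gamma\in\mathcal{M}_\infty(\mathbb{R}^d)$ and $x\in\mathbb{R}^d$. Convention: $e^{-\infty}=0$. The family is integrable if for all $\Lambda\in\mathcal{B}(\mathbb{R}^d)$ and $\gamma\in\mathcal{M}_\infty(\mathbb{R}^d)$, $0<Z_\Lambda(\gamma_{\Lambda^c}):=\int_{\mathcal{M}(\Lambda)}e^{-H_\Lambda(\gamma'_\Lambda+\gamma_{\Lambda^c})}\pi_\Lambda(\mathrm{d}\gamma'_\Lambda)<+\infty$. A probability measure $\mu$ on $\mathcal{M}(\mathbb{R}^d)$ is a Gibbs measure for $(H_\Lambda)$ if for all $\Lambda\in\mathcal{B}(\mathbb{R}^d)$ and all bounded measurable $f:\mathcal{M}(\mathbb{R}^d)\to\mathbb{R}$, $$\int f(\gamma)\,\mu(\mathrm{d}\gamma)=\int_{\mathcal{M}(\mathbb{R}^d)}\int_{\mathcal{M}(\Lambda)}f(\gamma'_\Lambda+\gamma_{\Lambda^c})\frac{1}{Z_\Lambda(\gamma_{\Lambda^c})}e^{-H_\Lambda(\gamma'_\Lambda+\gamma_{\Lambda^c})}\,\pi_\Lambda(\mathrm{d}\gamma'_\Lambda)\,\mu(\mathrm{d}\gamma);$$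 such a $\mu$ is supported in $\mathcal{M}_\infty(\mathbb{R}^d)$. Stationary means invariant under translations of $\mathbb{R}^d$. Reduced Campbell measure of a probability measure $\mu$ on $\mathcal{M}(\mathbb{R}^d)$: the measure on $\mathbb{R}^d\times\mathcal{M}(\mathbb{R}^d)$ given by $\mathcal{C}^!_\mu(f)=\int_{\mathcal{M}(\mathbb{R}^d)}\int_{\mathbb{R}^d}f(x,\gamma-\delta_x)\,\gamma(\mathrm{d}x)\,\mu(\mathrm{d}\gamma)$ for bounded non-negative measurable $f$. *)

theory Defs
  imports "HOL-Probability.Probability"
begin

definition bounded_borel :: "'a::euclidean_space set set" where
  "bounded_borel = {\<Lambda> \<in> sets borel. bounded \<Lambda>}"

(* Simple integer-valued measures on the Borel sets. *)
definition configs :: "'a::euclidean_space measure set" where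
  "configs = {\<gamma>. sets \<gamma> = sets borel \<and>
     (\<forall>\<Lambda>\<in>bounded_borel. \<exists>n::nat. emeasure \<gamma> \<Lambda> = of_nat n) \<and>
     (\<forall>x. emeasure \<gamma> {x} \<le> 1)}"

definition config_space :: "'a::euclidean_space measure measure" where
  "config_space = sigma configs
     {{\<gamma> \<in> configs. emeasure \<gamma> \<Lambda> = of_nat n} | \<Lambda> n. \<Lambda> \<in> bounded_borel}"

definition points :: "'a::euclidean_space measure \<Rightarrow> 'a set" where
  "points \<gamma> = {x. emeasure \<gamma> {x} > 0}"

(* The sum of the Dirac measures at the (possibly infinitely many) elements of S. *)
definition dirac_sum :: "'a::euclidean_space set \<Rightarrow> 'a measure" where
  "dirac_sum S = distr (count_space S) borel (\<lambda>x. x)"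

definition restr :: "'a::euclidean_space set \<Rightarrow> 'a measure \<Rightarrow> 'a measure" where
  "restr \<Lambda> \<gamma> = dirac_sum (points \<gamma> \<inter> \<Lambda>)"

(* The library has diff_measure for differences of measures, but no sum. *)
definition add_measure :: "'a measure \<Rightarrow> 'a measure \<Rightarrow> 'a measure" where
  "add_measure M N = measure_of (space M) (sets M) (\<lambda>A. emeasure M A + emeasure N A)"

definition translate :: "'a::euclidean_space \<Rightarrow> 'a measure \<Rightarrow> 'a measure" where
  "translate v \<gamma> = distr \<gamma> borel (\<lambda>x. x + v)"

(* P is the law of a Poisson process whose (locally finite, diffuse) intensity measure is \<rho>.
   The explicit weights also cover the degenerate rate 0, which poisson_pmf excludes. *)
definition poisson_process ::
  "'a::euclidean_space measure \<Rightarrow> 'a measure measure \<Rightarrow> bool" where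
  "poisson_process \<rho> P \<longleftrightarrow>
     prob_space P \<and> sets P = sets config_space \<and>
     (\<forall>A\<in>bounded_borel. \<forall>n::nat.
        measure P {\<gamma> \<in> space P. emeasure \<gamma> A = of_nat n}
          = measure \<rho> A ^ n / fact n * exp (- measure \<rho> A)) \<and>
     (\<forall>(I::nat set) A. finite I \<longrightarrow> (\<forall>i\<in>I. A i \<in> bounded_borel) \<longrightarrow> disjoint_family_on A I \<longrightarrow>
        prob_space.indep_vars P (\<lambda>_. borel) (\<lambda>i \<gamma>. emeasure \<gamma> (A i)) I)"

(* The Poisson process on \<Lambda> is a law on all configurations; since its intensity vanishes outside
   \<Lambda>, it is concentrated on the configurations contained in \<Lambda>. *)
definition poisson_on ::
  "'a::euclidean_space set \<Rightarrow> 'a measure measure \<Rightarrow> bool" where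
  "poisson_on \<Lambda> P \<longleftrightarrow> poisson_process (density lborel (indicator \<Lambda>)) P"

(* exp (- e) for an energy e, with exp (- \<infinity>) = 0; not meant for e = - \<infinity>. *)
definition exp_neg :: "ereal \<Rightarrow> real" where
  "exp_neg e = (if e = \<infinity> then 0 else exp (- real_of_ereal e))"

definition energy_family ::
  "('a::euclidean_space set \<Rightarrow> 'a measure \<Rightarrow> ereal) \<Rightarrow> bool" where
  "energy_family H \<longleftrightarrow>
     (\<forall>\<Lambda>\<in>bounded_borel. H \<Lambda> \<in> borel_measurable config_space \<and>
        (\<forall>\<gamma>\<in>configs. H \<Lambda> \<gamma> \<noteq> -\<infinity>)) \<and>
     (\<forall>\<Lambda>\<in>bounded_borel. \<forall>\<Lambda>'\<in>bounded_borel. \<Lambda> \<subseteq> \<Lambda>' \<longrightarrow>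
        (\<exists>\<phi> \<in> borel_measurable config_space. (\<forall>\<gamma>\<in>configs. \<phi> \<gamma> \<noteq> -\<infinity>) \<and>
           (\<forall>\<gamma>\<in>configs. H \<Lambda>' \<gamma> = H \<Lambda> \<gamma> + \<phi> (restr (- \<Lambda>) \<gamma>))))"

definition finite_energy_configs ::
  "('a::euclidean_space set \<Rightarrow> 'a measure \<Rightarrow> ereal) \<Rightarrow> 'a measure set" where
  "finite_energy_configs H = {\<gamma> \<in> configs. \<forall>\<Lambda>\<in>bounded_borel. H \<Lambda> \<gamma> < \<infinity>}"

(* h(x,\<eta>), where \<eta> = \<gamma> - \<delta>_x for a point x removable from \<gamma> = \<eta> + \<delta>_x. The value does not depend on
   the choice of \<Lambda>; it is unspecified if there is no suitable \<Lambda> or if \<eta> + \<delta>_x is not simple. *)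
definition local_energy ::
  "('a::euclidean_space set \<Rightarrow> 'a measure \<Rightarrow> ereal) \<Rightarrow> 'a \<Rightarrow> 'a measure \<Rightarrow> ereal" where
  "local_energy H x \<eta> =
     (let \<Lambda> = (SOME \<Lambda>. \<Lambda> \<in> bounded_borel \<and> x \<in> \<Lambda> \<and> H \<Lambda> \<eta> < \<infinity>)
      in H \<Lambda> (add_measure \<eta> (return borel x)) - H \<Lambda> \<eta>)"

(* In the next three definitions \<pi> \<Lambda> is the Poisson process on \<Lambda>, and the outer configuration \<eta>
   is to be supported in the complement of \<Lambda>. *)
definition partition_function ::
  "('a::euclidean_space set \<Rightarrow> 'a measure measure) \<Rightarrow> ('a set \<Rightarrow> 'a measure \<Rightarrow> ereal) \<Rightarrow>
   'a set \<Rightarrow> 'a measure \<Rightarrow> ennreal" where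
  "partition_function \<pi> H \<Lambda> \<eta> =
     (\<integral>\<^sup>+\<gamma>'. ennreal (exp_neg (H \<Lambda> (add_measure (restr \<Lambda> \<gamma>') \<eta>))) \<partial>\<pi> \<Lambda>)"

definition integrable_family ::
  "('a::euclidean_space set \<Rightarrow> 'a measure measure) \<Rightarrow> ('a set \<Rightarrow> 'a measure \<Rightarrow> ereal) \<Rightarrow> bool" where
  "integrable_family \<pi> H \<longleftrightarrow>
     (\<forall>\<Lambda>\<in>bounded_borel. \<forall>\<gamma>\<in>finite_energy_configs H.
        0 < partition_function \<pi> H \<Lambda> (restr (- \<Lambda>) \<gamma>) \<and>
        partition_function \<pi> H \<Lambda> (restr (- \<Lambda>) \<gamma>) < \<infinity>)"

(* Outside the finite energy configurations the partition function may be 0 or \<infinity>, and 1 / enn2real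
   is then 0. This is harmless: testing with the indicator of H \<Lambda> = \<infinity> shows that \<mu> gives full
   measure to the finite energy configurations. *)
definition gibbs_measure ::
  "('a::euclidean_space set \<Rightarrow> 'a measure measure) \<Rightarrow> ('a set \<Rightarrow> 'a measure \<Rightarrow> ereal) \<Rightarrow>
   'a measure measure \<Rightarrow> bool" where
  "gibbs_measure \<pi> H \<mu> \<longleftrightarrow>
     prob_space \<mu> \<and> sets \<mu> = sets config_space \<and>
     (\<forall>\<Lambda>\<in>bounded_borel. \<forall>f::'a measure \<Rightarrow> real.
        f \<in> borel_measurable config_space \<longrightarrow> bounded (f ` configs) \<longrightarrow>
        (\<integral>\<gamma>. f \<gamma> \<partial>\<mu>) =
        (\<integral>\<gamma>. (\<integral>\<gamma>'. f (add_measure (restr \<Lambda> \<gamma>') (restr (- \<Lambda>) \<gamma>))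
                  * (1 / enn2real (partition_function \<pi> H \<Lambda> (restr (- \<Lambda>) \<gamma>)))
                  * exp_neg (H \<Lambda> (add_measure (restr \<Lambda> \<gamma>') (restr (- \<Lambda>) \<gamma>))) \<partial>\<pi> \<Lambda>) \<partial>\<mu>))"

definition stationary :: "'a::euclidean_space measure measure \<Rightarrow> bool" where
  "stationary \<mu> \<longleftrightarrow> (\<forall>v. distr \<mu> config_space (translate v) = \<mu>)"

definition reduced_campbell ::
  "'a::euclidean_space measure measure \<Rightarrow> ('a \<times> 'a measure) measure" where
  "reduced_campbell \<mu> =
     measure_of (space (borel \<Otimes>\<^sub>M config_space)) (sets (borel \<Otimes>\<^sub>M config_space))
       (\<lambda>A. \<integral>\<^sup>+\<gamma>. (\<integral>\<^sup>+x. indicator A (x, diff_measure \<gamma> (return borel x)) \<partial>\<gamma>) \<partial>\<mu>)"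

end

theory Submission
  imports Defs
begin

text \<open>The Mecke equation says that the reduced Campbell measure of a Poisson process is the product of
  its intensity and its law. On events \<open>N(C) = n\<^sub>C\<close> for finitely many disjoint sets \<open>C\<close> it reduces to
  \<open>(n + 1) P (N = n + 1) = \<rho> P (N = n)\<close> for a Poisson variable of rate \<open>\<rho>\<close>, and such events form a
  generator up to refinement of the sets. For a Gibbs measure, resample the configuration inside a ball
  \<open>\<Lambda>\<close>: the law of the inner configuration has density proportional to \<open>exp (- H\<^sub>\<Lambda>)\<close> with respect to
  the Poisson process, so the Mecke equation replaces the sum over the points in \<open>\<Lambda>\<close> by an integral
  over \<open>x \<in> \<Lambda>\<close>, at the price of \<open>exp (- H\<^sub>\<Lambda>(\<gamma> + \<delta>\<^sub>x))\<close> in place of \<open>exp (- H\<^sub>\<Lambda>(\<gamma>))\<close>. On finite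
  energy configurations the quotient is \<open>exp (- h(x, \<gamma>))\<close>, and resampling backwards gives the
  identity for \<open>x \<in> \<Lambda>\<close>. The indicator of the finite energy configurations makes up for the missing
  heredity. Finally \<open>\<Lambda>\<close> exhausts the space.\<close>

subsection \<open>Configurations\<close>

text \<open>Without heredity, removing a point from a configuration of finite energy can make the
  energy infinite. The Mecke equation still charges such a reduced configuration, but there the
  weight without the point is 0 and the quotient of the two weights has no meaning. The indicator
  makes the integrand vanish exactly there, so the quotient is formed only where its denominator is
  positive. The prefactor 1/Z depends on the outer configuration alone and stands before both inner
  integrals, so only these have to be compared.

  Two obstacles concern measurability. For the wrong x, \<gamma> - \<delta>_x and \<gamma> +
  \<delta>_x leave the simple configurations; total operations \<open>del_pt\<close> and
  \<open>ins_pt\<close> replace them, and the difference sits on null sets: \<gamma>-almost every x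
  is a point of \<gamma>, while Lebesgue-almost none is. And \<open>local_energy\<close> rests on an
  arbitrary choice of \<Lambda>, so its measurability is not evident; it is traded for the energy
  increment in a ball whose radius depends measurably on x.\<close>

lemma bounded_borelD [dest]: "\<Lambda> \<in> bounded_borel \<Longrightarrow> \<Lambda> \<in> sets borel" "\<Lambda> \<in> bounded_borel \<Longrightarrow> bounded \<Lambda>"
  by (auto simp: bounded_borel_def)

lemma bounded_borel_ball [simp, intro]: "ball x r \<in> bounded_borel"
  by (simp add: bounded_borel_def)

lemma bounded_borel_singleton [simp, intro]: "{x} \<in> bounded_borel"
  by (simp add: bounded_borel_def)

lemma bounded_borel_Int [intro]:
  "A \<in> sets borel \<Longrightarrow> B \<in> bounded_borel \<Longrightarrow> A \<inter> B \<in> bounded_borel"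
  "A \<in> bounded_borel \<Longrightarrow> B \<in> sets borel \<Longrightarrow> A \<inter> B \<in> bounded_borel"
  by (auto simp: bounded_borel_def bounded_Int)

lemma bounded_borel_Diff [intro]:
  "A \<in> bounded_borel \<Longrightarrow> B \<in> sets borel \<Longrightarrow> A - B \<in> bounded_borel"
  by (auto simp: bounded_borel_def Diff_eq bounded_Int)

lemma bounded_borel_Un [intro]:
  "A \<in> bounded_borel \<Longrightarrow> B \<in> bounded_borel \<Longrightarrow> A \<union> B \<in> bounded_borel"
  by (auto simp: bounded_borel_def)

lemma UN_ball_nat: "(\<Union>n. ball (0::'a::euclidean_space) (real n)) = UNIV"
  using reals_Archimedean2 by (auto simp: dist_norm)

lemma incseq_ball_nat: "incseq (\<lambda>n. ball (0::'a::euclidean_space) (real n))"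
  by (auto simp: incseq_def)

lemma bounded_borel_subset_ball:
  fixes \<Lambda> :: "'a::euclidean_space set"
  assumes "\<Lambda> \<in> bounded_borel"
  obtains n :: nat where "\<Lambda> \<subseteq> ball 0 (real n)"
proof -
  from assms obtain r where "\<Lambda> \<subseteq> ball 0 r"
    using bounded_subset_ballD[OF bounded_borelD(2)] by blast
  moreover obtain n :: nat where "r < real n"
    using reals_Archimedean2 by blast
  ultimately show ?thesis
    by (intro that[of n]) (auto simp: subset_eq)
qed

section \<open>Points of a single configuration\<close>

context
  fixes \<gamma> :: "'a::euclidean_space measure"
  assumes \<gamma>: "\<gamma> \<in> configs"
begin

lemma sets_config [measurable_cong]: "sets \<gamma> = sets borel"
  using \<gamma> by (simp add: configs_def)

lemma config_nat: "\<Lambda> \<in> bounded_borel \<Longrightarrow> \<exists>n::nat. emeasure \<gamma> \<Lambda> = of_nat n"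
  using \<gamma> by (simp add: configs_def)

lemma config_finite: "\<Lambda> \<in> bounded_borel \<Longrightarrow> emeasure \<gamma> \<Lambda> < \<infinity>"
  using config_nat[of \<Lambda>] by (auto simp: of_nat_less_top)

lemma config_lt_1: "\<Lambda> \<in> bounded_borel \<Longrightarrow> emeasure \<gamma> \<Lambda> < 1 \<Longrightarrow> emeasure \<gamma> \<Lambda> = 0"
  using config_nat[of \<Lambda>] by auto

lemma emeasure_config_singleton: "emeasure \<gamma> {x} = indicator (points \<gamma>) x"
proof -
  obtain n :: nat where n: "emeasure \<gamma> {x} = of_nat n"
    using config_nat[of "{x}"] by auto
  moreover have "emeasure \<gamma> {x} \<le> 1"
    using \<gamma> by (auto simp: configs_def)
  ultimately have "n = 0 \<or> n = 1" by (metis le_neq_implies_less less_one of_nat_1 of_nat_le_iff)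
  with n show ?thesis by (auto simp: points_def indicator_def)
qed

text \<open>A point of mass 0 has small balls of mass less than 1, hence of mass 0; by the Lindelof
  property countably many of these balls cover the complement of the points.\<close>
lemma points_null: "open (- points \<gamma>)" "emeasure \<gamma> (- points \<gamma>) = 0"
proof -
  define \<U> where "\<U> = {U. open U \<and> emeasure \<gamma> U = 0}"
  have "\<And>U. U \<in> \<U> \<Longrightarrow> open U"
    by (simp add: \<U>_def)
  then obtain \<V> where \<V>: "\<V> \<subseteq> \<U>" "countable \<V>" "\<Union>\<V> = \<Union>\<U>"
    by (rule Lindelof)
  have "emeasure \<gamma> (\<Union>\<V>) = 0"
    using \<V> null_sets_UN'[of \<V> "\<lambda>U. U" \<gamma>]
    by (simp add: null_sets_def \<U>_def sets_config subset_eq)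
  then have null: "emeasure \<gamma> (\<Union>\<U>) = 0" by (simp add: \<V>)
  have "open (\<Union>\<U>)" by (auto simp: \<U>_def)
  have "\<Union>\<U> = - points \<gamma>"
  proof (intro equalityI subsetI)
    fix x assume "x \<in> \<Union>\<U>"
    then have "emeasure \<gamma> {x} \<le> emeasure \<gamma> (\<Union>\<U>)"
      using \<open>open (\<Union>\<U>)\<close> by (intro emeasure_mono) (auto simp: sets_config)
    with null show "x \<in> - points \<gamma>" by (simp add: points_def)
  next
    fix x assume x: "x \<in> - points \<gamma>"
    let ?B = "\<lambda>n::nat. ball x (1 / real (Suc n))"
    have INT: "(\<Inter>n. ?B n) = {x}"
    proof (intro equalityI subsetI)
      fix y assume y: "y \<in> (\<Inter>n. ?B n)"
      show "y \<in> {x}"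
      proof (rule ccontr)
        assume "y \<notin> {x}"
        then obtain n where "inverse (real (Suc n)) < dist x y"
          using reals_Archimedean[of "dist x y"] by auto
        moreover from y have "y \<in> ?B n" by blast
        ultimately show False by (simp add: inverse_eq_divide)
      qed
    qed auto
    have dec: "decseq ?B"
      unfolding decseq_def by (intro allI impI subset_ball frac_le) simp_all
    have "(\<lambda>n. emeasure \<gamma> (?B n)) \<longlonglongrightarrow> emeasure \<gamma> (\<Inter>n. ?B n)"
      using config_finite[OF bounded_borel_ball] dec
      by (intro Lim_emeasure_decseq) (auto simp: sets_config less_le)
    then have "(\<lambda>n. emeasure \<gamma> (?B n)) \<longlonglongrightarrow> 0"
      unfolding INT using x by (simp add: emeasure_config_singleton)
    then have "\<forall>\<^sub>F n in sequentially. emeasure \<gamma> (?B n) < 1"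
      by (rule order_tendstoD) simp
    then obtain n where "emeasure \<gamma> (?B n) < 1"
      by (auto simp: eventually_sequentially)
    then have "?B n \<in> \<U>"
      by (simp add: \<U>_def config_lt_1)
    then show "x \<in> \<Union>\<U>" by (rule UnionI) simp
  qed
  with null \<open>open (\<Union>\<U>)\<close> show "open (- points \<gamma>)" "emeasure \<gamma> (- points \<gamma>) = 0" by auto
qed

lemma points_borel [measurable]: "points \<gamma> \<in> sets borel"
  using points_null(1) by (metis borel_comp borel_open double_complement)

lemma AE_in_points: "AE x in \<gamma>. x \<in> points \<gamma>"
  by (rule AE_I[OF _ points_null(2)]) (auto simp: sets_config borel_open[OF points_null(1)])

lemma finite_points: assumes "\<Lambda> \<in> bounded_borel" shows "finite (points \<gamma> \<inter> \<Lambda>)"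
proof (rule ccontr)
  assume inf: "infinite (points \<gamma> \<inter> \<Lambda>)"
  obtain n :: nat where n: "emeasure \<gamma> \<Lambda> = of_nat n"
    using assms config_nat by blast
  \<comment> \<open>One point more than the mass of \<Lambda> allows, each point having mass exactly
    1.\<close>
  obtain F where F: "finite F" "card F = Suc n" "F \<subseteq> points \<gamma> \<inter> \<Lambda>"
    using infinite_arbitrarily_large[OF inf] by blast
  have "of_nat (Suc n) = (\<Sum>x\<in>F. emeasure \<gamma> {x})"
    using F by (auto simp: emeasure_config_singleton subset_eq intro!: trans[OF _ sum.cong[of F F "\<lambda>_. 1"]])
  also have "\<dots> = emeasure \<gamma> F"
    using F by (intro emeasure_eq_sum_singleton[symmetric]) (auto simp: sets_config)
  also have "\<dots> \<le> of_nat n"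
    unfolding n[symmetric] using F assms by (intro emeasure_mono) (auto simp: sets_config)
  finally show False by (simp only: of_nat_le_iff Suc_n_not_le_n)
qed

lemma countable_points: "countable (points \<gamma>)"
proof -
  have "points \<gamma> = (\<Union>n::nat. points \<gamma> \<inter> ball 0 (real n))"
    unfolding Int_UN_distrib[symmetric] UN_ball_nat by simp
  also have "countable \<dots>"
    using countable_finite[OF finite_points[OF bounded_borel_ball]] by (intro countable_UN) simp_all
  finally show ?thesis .
qed

text \<open>\<open>restr\<close> is built from the set of points alone. Nothing is lost by this: the
  points are countably many atoms of mass 1, and their complement is null.\<close>

lemma emeasure_restr:
  assumes \<Lambda>[measurable]: "\<Lambda> \<in> sets borel" and A[measurable]: "A \<in> sets borel"
  shows "emeasure (restr \<Lambda> \<gamma>) A = emeasure \<gamma> (A \<inter> \<Lambda>)"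
proof -
  let ?S = "points \<gamma> \<inter> \<Lambda>"
  have "emeasure (restr \<Lambda> \<gamma>) A = emeasure (count_space ?S) (A \<inter> ?S)"
    by (simp add: restr_def dirac_sum_def emeasure_distr)
  also have "\<dots> = (\<integral>\<^sup>+x. indicator (A \<inter> ?S) x \<partial>count_space ?S)"
    by (intro nn_integral_indicator[symmetric]) auto
  also have "\<dots> = (\<integral>\<^sup>+x. indicator (A \<inter> ?S) x * indicator ?S x \<partial>count_space UNIV)"
    by (simp add: nn_integral_count_space_indicator)
  also have "\<dots> = (\<integral>\<^sup>+x. indicator (points \<gamma>) x * indicator (A \<inter> ?S) x \<partial>count_space UNIV)"
    by (intro nn_integral_cong) (auto simp: indicator_def)
  also have "\<dots> = (\<integral>\<^sup>+x. emeasure \<gamma> {x} \<partial>count_space (A \<inter> ?S))"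
    by (subst nn_integral_count_space_indicator) (auto simp: emeasure_config_singleton)
  also have "\<dots> = emeasure \<gamma> (A \<inter> ?S)"
    by (intro emeasure_countable_singleton[symmetric] countable_subset[OF _ countable_points])
       (auto simp: sets_config)
  also have "\<dots> = emeasure \<gamma> (A \<inter> \<Lambda>)"
    using AE_in_points by (intro emeasure_eq_AE) (auto simp: sets_config)
  finally show ?thesis .
qed

end

lemma sets_restr [simp, measurable_cong]: "sets (restr \<Lambda> \<gamma>) = sets borel"
  by (simp add: restr_def dirac_sum_def)

lemma configsI:
  assumes "sets \<gamma> = sets borel"
    and "\<And>\<Lambda>. \<Lambda> \<in> bounded_borel \<Longrightarrow> \<exists>n::nat. emeasure \<gamma> \<Lambda> = of_nat n"
    and "\<And>x. emeasure \<gamma> {x} \<le> 1"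
  shows "\<gamma> \<in> configs"
  using assms by (auto simp: configs_def)

section \<open>Deleting, inserting and gluing\<close>

lemma sets_add_measure [simp, measurable_cong]: "sets (add_measure M N) = sets M"
  by (simp add: add_measure_def)

lemma emeasure_add_measure:
  assumes "sets M = sets N" "A \<in> sets M"
  shows "emeasure (add_measure M N) A = emeasure M A + emeasure N A"
  unfolding add_measure_def
proof (rule emeasure_measure_of_sigma[OF sets.sigma_algebra_axioms _ _ assms(2)])
  show "positive (sets M) (\<lambda>A. emeasure M A + emeasure N A)"
    by (simp add: positive_def)
  show "countably_additive (sets M) (\<lambda>A. emeasure M A + emeasure N A)"
    using assms by (auto simp: countably_additive_def suminf_add[symmetric] suminf_emeasure)
qed

text \<open>Unlike \<open>\<gamma> - \<delta>\<^sub>x\<close> and \<open>\<gamma> + \<delta>\<^sub>x\<close>, these operations map configurations to configurations for every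
  \<open>x\<close>: they leave \<open>\<gamma>\<close> alone if \<open>x \<notin> \<gamma>\<close> and \<open>x \<in> \<gamma>\<close>, respectively.\<close>
definition del_pt :: "'a::euclidean_space \<Rightarrow> 'a measure \<Rightarrow> 'a measure" where
  "del_pt x \<gamma> = density \<gamma> (indicator (- {x}))"

definition ins_pt :: "'a::euclidean_space \<Rightarrow> 'a measure \<Rightarrow> 'a measure" where
  "ins_pt x \<gamma> = add_measure (del_pt x \<gamma>) (return borel x)"

text \<open>The configuration at which the Gibbs kernel is evaluated. The two parts live on disjoint
  sets, so the sum is simple for any two configurations.\<close>

definition glue :: "'a::euclidean_space set \<Rightarrow> 'a measure \<Rightarrow> 'a measure \<Rightarrow> 'a measure" where
  "glue \<Lambda> \<gamma>' \<gamma> = add_measure (restr \<Lambda> \<gamma>') (restr (- \<Lambda>) \<gamma>)"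

lemma sets_del_pt [simp, measurable_cong]: "sets (del_pt x \<gamma>) = sets \<gamma>"
  by (simp add: del_pt_def)

lemma sets_ins_pt [simp, measurable_cong]: "sets (ins_pt x \<gamma>) = sets \<gamma>"
  by (simp add: ins_pt_def)

lemma sets_glue [simp, measurable_cong]: "sets (glue \<Lambda> \<gamma>' \<gamma>) = sets borel"
  by (simp add: glue_def)

lemma emeasure_del_pt:
  assumes "sets \<gamma> = sets borel" "A \<in> sets borel"
  shows "emeasure (del_pt x \<gamma>) A = emeasure \<gamma> (A - {x})"
proof -
  note [simp, measurable_cong] = assms(1)
  have "emeasure (del_pt x \<gamma>) A = (\<integral>\<^sup>+ y. indicator (- {x}) y * indicator A y \<partial>\<gamma>)"
    unfolding del_pt_def using assms(2) by (intro emeasure_density borel_measurable_indicator) auto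
  also have "\<dots> = (\<integral>\<^sup>+ y. indicator (A - {x}) y \<partial>\<gamma>)"
    by (intro nn_integral_cong) (auto simp: indicator_def)
  also have "\<dots> = emeasure \<gamma> (A - {x})"
    using assms by (intro nn_integral_indicator) auto
  finally show ?thesis .
qed

lemma emeasure_ins_pt:
  assumes "sets \<gamma> = sets borel" "A \<in> sets borel"
  shows "emeasure (ins_pt x \<gamma>) A = emeasure \<gamma> (A - {x}) + indicator A x"
  using assms by (simp add: ins_pt_def emeasure_add_measure emeasure_del_pt)

lemma emeasure_glue:
  assumes "\<gamma>' \<in> configs" "\<gamma> \<in> configs" "\<Lambda> \<in> sets borel" "A \<in> sets borel"
  shows "emeasure (glue \<Lambda> \<gamma>' \<gamma>) A = emeasure \<gamma>' (A \<inter> \<Lambda>) + emeasure \<gamma> (A - \<Lambda>)"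
  using assms by (simp add: glue_def emeasure_add_measure emeasure_restr Diff_eq)

lemma del_pt_configs: assumes "\<gamma> \<in> configs" shows "del_pt x \<gamma> \<in> configs"
proof (rule configsI)
  note [simp] = sets_config[OF assms]
  show "sets (del_pt x \<gamma>) = sets borel" by simp
  show "\<exists>n::nat. emeasure (del_pt x \<gamma>) \<Lambda> = of_nat n" if "\<Lambda> \<in> bounded_borel" for \<Lambda>
    using config_nat[OF assms bounded_borel_Diff[where B="{x}", OF that]] bounded_borelD(1)[OF that]
    by (simp add: emeasure_del_pt)
  show "emeasure (del_pt x \<gamma>) {y} \<le> 1" for y
    by (cases "y = x") (auto simp: emeasure_del_pt insert_Diff_if emeasure_config_singleton[OF assms] indicator_def)
qed

lemma ins_pt_configs: assumes "\<gamma> \<in> configs" shows "ins_pt x \<gamma> \<in> configs"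
proof (rule configsI)
  note [simp] = sets_config[OF assms]
  show "sets (ins_pt x \<gamma>) = sets borel" by simp
  show "\<exists>n::nat. emeasure (ins_pt x \<gamma>) \<Lambda> = of_nat n" if \<Lambda>: "\<Lambda> \<in> bounded_borel" for \<Lambda>
  proof -
    obtain n :: nat where "emeasure \<gamma> (\<Lambda> - {x}) = of_nat n"
      using config_nat[OF assms bounded_borel_Diff[where B="{x}", OF \<Lambda>]] by auto
    with bounded_borelD(1)[OF \<Lambda>] show ?thesis
      by (intro exI[of _ "n + (if x \<in> \<Lambda> then 1 else 0)"]) (auto simp: emeasure_ins_pt)
  qed
  show "emeasure (ins_pt x \<gamma>) {y} \<le> 1" for y
    by (cases "y = x") (auto simp: emeasure_ins_pt insert_Diff_if emeasure_config_singleton[OF assms] indicator_def)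
qed

lemma glue_configs:
  assumes "\<gamma>' \<in> configs" "\<gamma> \<in> configs" "\<Lambda> \<in> sets borel"
  shows "glue \<Lambda> \<gamma>' \<gamma> \<in> configs"
proof (rule configsI)
  show "sets (glue \<Lambda> \<gamma>' \<gamma>) = sets borel" by simp
  show "\<exists>n::nat. emeasure (glue \<Lambda> \<gamma>' \<gamma>) A = of_nat n" if A: "A \<in> bounded_borel" for A
  proof -
    obtain n :: nat where "emeasure \<gamma>' (A \<inter> \<Lambda>) = of_nat n"
      using config_nat[OF assms(1) bounded_borel_Int(2)[OF A assms(3)]] by auto
    moreover obtain m :: nat where "emeasure \<gamma> (A - \<Lambda>) = of_nat m"
      using config_nat[OF assms(2) bounded_borel_Diff[OF A assms(3)]] by auto
    ultimately show ?thesis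
      using bounded_borelD(1)[OF A] assms by (intro exI[of _ "n + m"]) (simp add: emeasure_glue)
  qed
  show "emeasure (glue \<Lambda> \<gamma>' \<gamma>) {y} \<le> 1" for y
    using assms by (cases "y \<in> \<Lambda>") (auto simp: emeasure_glue insert_Diff_if emeasure_config_singleton indicator_def)
qed

lemma restr_configs:
  assumes "\<gamma> \<in> configs" "\<Lambda> \<in> sets borel"
  shows "restr \<Lambda> \<gamma> \<in> configs"
proof (rule configsI)
  show "\<exists>n::nat. emeasure (restr \<Lambda> \<gamma>) A = of_nat n" if "A \<in> bounded_borel" for A
    using config_nat[OF assms(1) bounded_borel_Int(2)[OF that assms(2)]] bounded_borelD(1)[OF that] assms
    by (simp add: emeasure_restr)
  show "emeasure (restr \<Lambda> \<gamma>) {y} \<le> 1" for y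
    using assms by (auto simp: emeasure_restr emeasure_config_singleton Int_insert_left indicator_def)
qed simp

text \<open>\<open>diff_measure\<close> subtracts set by set, with truncation at 0. At a point of
  \<gamma> exactly its mass 1 is removed; elsewhere the truncated differences need not be
  additive.\<close>

lemma diff_measure_return_eq_del_pt:
  assumes "\<gamma> \<in> configs" "x \<in> points \<gamma>"
  shows "diff_measure \<gamma> (return borel x) = del_pt x \<gamma>"
proof -
  note [simp] = sets_config[OF assms(1)]
  have eq: "emeasure \<gamma> A - emeasure (return borel x) A = emeasure (del_pt x \<gamma>) A" if "A \<in> sets borel" for A
  proof (cases "x \<in> A")
    case True
    then have "emeasure \<gamma> A = emeasure \<gamma> ((A - {x}) \<union> {x})"
      by (simp add: insert_absorb)
    also have "\<dots> = emeasure \<gamma> (A - {x}) + emeasure \<gamma> {x}"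
      using that by (intro plus_emeasure[symmetric]) auto
    finally show ?thesis
      using assms that True by (simp add: emeasure_config_singleton emeasure_del_pt)
  qed (use that in \<open>simp add: emeasure_del_pt\<close>)
  \<comment> \<open>The set function is rewritten before \<open>measure_of\<close> is evaluated: it
    agrees with a measure on every measurable set, so its additivity comes for free.\<close>
  have "diff_measure \<gamma> (return borel x) = measure_of (space \<gamma>) (sets \<gamma>) (emeasure (del_pt x \<gamma>))"
    unfolding diff_measure_def
    using sets.sigma_sets_eq[of \<gamma>] sets.space_closed[of \<gamma>] eq by (intro measure_of_eq) simp_all
  also have "\<dots> = del_pt x \<gamma>"
    using measure_of_of_measure[of "del_pt x \<gamma>"] by (simp add: del_pt_def)
  finally show ?thesis .
qed

text \<open>The deletion inside \<open>ins_pt\<close> then removes only a null set. This links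
  \<open>ins_pt\<close> to the sum that occurs in \<open>local_energy\<close>.\<close>

lemma ins_pt_eq_add_return:
  assumes "\<gamma> \<in> configs" "x \<notin> points \<gamma>"
  shows "add_measure \<gamma> (return borel x) = ins_pt x \<gamma>"
proof (rule measure_eqI)
  note [simp] = sets_config[OF assms(1)]
  fix A assume A: "A \<in> sets (add_measure \<gamma> (return borel x))"
  have "AE y in \<gamma>. y \<noteq> x"
    using AE_in_points[OF assms(1)] by eventually_elim (use assms(2) in auto)
  then have "emeasure \<gamma> A = emeasure \<gamma> (A - {x})"
    using A by (intro emeasure_eq_AE) auto
  with A show "emeasure (add_measure \<gamma> (return borel x)) A = emeasure (ins_pt x \<gamma>) A"
    by (simp add: emeasure_add_measure emeasure_ins_pt)
qed simp

lemma ins_pt_del_pt: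
  assumes "\<gamma> \<in> configs" "x \<in> points \<gamma>"
  shows "ins_pt x (del_pt x \<gamma>) = \<gamma>"
proof (rule measure_eqI)
  note [simp] = sets_config[OF assms(1)]
  fix A assume A: "A \<in> sets (ins_pt x (del_pt x \<gamma>))"
  show "emeasure (ins_pt x (del_pt x \<gamma>)) A = emeasure \<gamma> A"
  proof (cases "x \<in> A")
    case True
    then have "emeasure \<gamma> A = emeasure \<gamma> ((A - {x}) \<union> {x})"
      by (simp add: insert_absorb)
    also have "\<dots> = emeasure \<gamma> (A - {x}) + emeasure \<gamma> {x}"
      using A by (intro plus_emeasure[symmetric]) auto
    finally show ?thesis
      using assms A True by (simp add: emeasure_config_singleton emeasure_del_pt emeasure_ins_pt)
  qed (use A in \<open>simp add: emeasure_del_pt emeasure_ins_pt\<close>)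
qed simp

text \<open>A point of \<Lambda> can only come from the inner configuration. This moves the deletion
  into the Poisson part, where the Mecke equation applies.\<close>

lemma del_pt_glue:
  assumes "\<gamma>' \<in> configs" "\<gamma> \<in> configs" "\<Lambda> \<in> sets borel" "x \<in> \<Lambda>"
  shows "del_pt x (glue \<Lambda> \<gamma>' \<gamma>) = glue \<Lambda> (del_pt x \<gamma>') \<gamma>"
proof (rule measure_eqI)
  fix A assume A: "A \<in> sets (del_pt x (glue \<Lambda> \<gamma>' \<gamma>))"
  have "A - {x} - \<Lambda> = A - \<Lambda>" "(A - {x}) \<inter> \<Lambda> = A \<inter> \<Lambda> - {x}"
    using assms(4) by auto
  with A assms show "emeasure (del_pt x (glue \<Lambda> \<gamma>' \<gamma>)) A = emeasure (glue \<Lambda> (del_pt x \<gamma>') \<gamma>) A"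
    by (simp add: emeasure_del_pt emeasure_glue del_pt_configs sets_config)
qed simp

text \<open>The outer configuration is all that the term \<phi> of an energy decomposition sees, so
  \<phi> does not notice an insertion inside \<Lambda>.\<close>

lemma restr_compl_ins_pt:
  assumes "\<gamma> \<in> configs" "\<Lambda> \<in> sets borel" "x \<in> \<Lambda>"
  shows "restr (- \<Lambda>) (ins_pt x \<gamma>) = restr (- \<Lambda>) \<gamma>"
proof (rule measure_eqI)
  fix A assume A: "A \<in> sets (restr (- \<Lambda>) (ins_pt x \<gamma>))"
  have "A \<inter> - \<Lambda> - {x} = A \<inter> - \<Lambda>"
    using assms(3) by auto
  with A assms show "emeasure (restr (- \<Lambda>) (ins_pt x \<gamma>)) A = emeasure (restr (- \<Lambda>) \<gamma>) A"
    by (simp add: emeasure_restr ins_pt_configs emeasure_ins_pt sets_config)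
qed simp

lemma points_glue:
  assumes "\<gamma>' \<in> configs" "\<gamma> \<in> configs" "\<Lambda> \<in> sets borel"
  shows "points (glue \<Lambda> \<gamma>' \<gamma>) \<inter> \<Lambda> = points \<gamma>' \<inter> \<Lambda>"
  using assms by (auto simp: points_def emeasure_glue)

subsection \<open>Measurability\<close>

lemma space_config_space [simp]: "space config_space = configs"
  unfolding config_space_def by (intro space_measure_of) auto

lemma sets_config_space:
  "sets config_space =
     sigma_sets configs {{\<gamma> \<in> configs. emeasure \<gamma> \<Lambda> = of_nat n} | \<Lambda> n. \<Lambda> \<in> bounded_borel}"
  unfolding config_space_def by (intro sets_measure_of) auto

lemma measurable_configI:
  assumes "\<And>\<omega>. \<omega> \<in> space M \<Longrightarrow> T \<omega> \<in> configs"
    and "\<And>\<Lambda>. \<Lambda> \<in> bounded_borel \<Longrightarrow> (\<lambda>\<omega>. emeasure (T \<omega>) \<Lambda>) \<in> borel_measurable M"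
  shows "T \<in> measurable M config_space"
proof (rule measurable_sigma_sets[OF sets_config_space])
  fix Y assume "Y \<in> {{\<gamma> \<in> configs. emeasure \<gamma> \<Lambda> = of_nat n} | \<Lambda> n. \<Lambda> \<in> (bounded_borel :: 'b set set)}"
  then obtain \<Lambda> and n :: nat where Y: "Y = {\<gamma> \<in> configs. emeasure \<gamma> \<Lambda> = of_nat n}" "\<Lambda> \<in> bounded_borel"
    by auto
  have "T -` Y \<inter> space M = (\<lambda>\<omega>. emeasure (T \<omega>) \<Lambda>) -` {of_nat n} \<inter> space M"
    using assms(1) by (auto simp: Y)
  with assms(2)[OF Y(2)] show "T -` Y \<inter> space M \<in> sets M"
    by simp
qed (use assms(1) in auto)

text \<open>Counts of bounded sets are natural numbers, so the preimage of any set of values is a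
  countable union of generating events.\<close>

lemma measurable_emeasure_config_bounded:
  assumes "\<Lambda> \<in> bounded_borel"
  shows "(\<lambda>\<gamma>. emeasure \<gamma> \<Lambda>) \<in> borel_measurable config_space"
proof (rule measurableI)
  fix B :: "ennreal set"
  have "(\<lambda>\<gamma>. emeasure \<gamma> \<Lambda>) -` B \<inter> space config_space =
      (\<Union>n\<in>{n::nat. of_nat n \<in> B}. {\<gamma> \<in> configs. emeasure \<gamma> \<Lambda> = of_nat n})"
    using config_nat[OF _ assms] by fastforce
  also have "\<dots> \<in> sets config_space"
    unfolding sets_config_space using assms
    by (intro sigma_sets_UNION countable_image) (auto intro!: sigma_sets.Basic)
  finally show "(\<lambda>\<gamma>. emeasure \<gamma> \<Lambda>) -` B \<inter> space config_space \<in> sets config_space" .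
qed simp

lemma emeasure_config_SUP:
  assumes "\<gamma> \<in> configs" "A \<in> sets borel"
  shows "emeasure \<gamma> A = (SUP n::nat. emeasure \<gamma> (A \<inter> ball 0 (real n)))"
proof -
  have "(SUP n::nat. emeasure \<gamma> (A \<inter> ball 0 (real n))) = emeasure \<gamma> (\<Union>n::nat. A \<inter> ball 0 (real n))"
    using assms incseq_ball_nat by (intro SUP_emeasure_incseq) (auto simp: sets_config incseq_def)
  also have "(\<Union>n::nat. A \<inter> ball 0 (real n)) = A"
    unfolding Int_UN_distrib[symmetric] UN_ball_nat by simp
  finally show ?thesis ..
qed

lemma measurable_emeasure_config [measurable]:
  assumes "A \<in> sets borel"
  shows "(\<lambda>\<gamma>. emeasure \<gamma> A) \<in> borel_measurable config_space"
proof -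
  have "(\<lambda>\<gamma>. SUP n::nat. emeasure \<gamma> (A \<inter> ball 0 (real n))) \<in> borel_measurable config_space"
    using assms by (intro borel_measurable_SUP measurable_emeasure_config_bounded) auto
  then show ?thesis
    using assms by (subst measurable_cong[OF emeasure_config_SUP]) auto
qed

section \<open>Configurations that depend measurably on a parameter\<close>

context
  fixes M :: "'b measure" and T :: "'b \<Rightarrow> 'a::euclidean_space measure"
  assumes T [measurable]: "T \<in> measurable M config_space"
begin

lemma T_configs: "\<omega> \<in> space M \<Longrightarrow> T \<omega> \<in> configs"
  using measurable_space[OF T] by simp

text \<open>A Dynkin argument starting from rectangles. The bounded window \<Lambda> keeps all
  masses finite, so that a complement turns into a difference of masses; the whole of
  \<open>T \<omega>\<close> may have infinite mass.\<close>

lemma measurable_emeasure_section_bounded: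
  assumes S: "S \<in> sets (borel \<Otimes>\<^sub>M M)" and \<Lambda>: "\<Lambda> \<in> bounded_borel"
  shows "(\<lambda>\<omega>. emeasure (T \<omega>) (\<Lambda> \<inter> (\<lambda>x. (x, \<omega>)) -` S)) \<in> borel_measurable M"
  using Int_stable_pair_measure_generator pair_measure_closed S[unfolded sets_pair_measure]
proof (induction S rule: sigma_sets_induct_disjoint)
  case (basic S)
  then obtain A B where S: "S = A \<times> B" and [measurable]: "A \<in> sets borel" "B \<in> sets M"
    by auto
  have [measurable]: "\<Lambda> \<in> sets borel"
    using \<Lambda> by auto
  have "\<Lambda> \<inter> (\<lambda>x. (x, \<omega>)) -` S = (if \<omega> \<in> B then \<Lambda> \<inter> A else {})" for \<omega>
    by (auto simp: S)
  then have "(\<lambda>\<omega>. emeasure (T \<omega>) (\<Lambda> \<inter> (\<lambda>x. (x, \<omega>)) -` S)) =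
      (\<lambda>\<omega>. emeasure (T \<omega>) (\<Lambda> \<inter> A) * indicator B \<omega>)"
    by (auto simp: fun_eq_iff indicator_def)
  also have "\<dots> \<in> borel_measurable M"
    by measurable
  finally show ?case .
next
  case empty
  then show ?case by simp
next
  case (compl S)
  have [measurable]: "\<Lambda> \<in> sets borel"
    using \<Lambda> by auto
  have S: "S \<in> sets (borel \<Otimes>\<^sub>M M)"
    using compl(1) by (simp add: sets_pair_measure)
  have "emeasure (T \<omega>) (\<Lambda> \<inter> (\<lambda>x. (x, \<omega>)) -` (space borel \<times> space M - S)) =
      emeasure (T \<omega>) \<Lambda> - emeasure (T \<omega>) (\<Lambda> \<inter> (\<lambda>x. (x, \<omega>)) -` S)" if \<omega>: "\<omega> \<in> space M" for \<omega>
  proof -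
    have "\<Lambda> \<inter> (\<lambda>x. (x, \<omega>)) -` (space borel \<times> space M - S) = \<Lambda> - \<Lambda> \<inter> (\<lambda>x. (x, \<omega>)) -` S"
      using \<omega> by auto
    moreover have "emeasure (T \<omega>) (\<Lambda> \<inter> (\<lambda>x. (x, \<omega>)) -` S) \<noteq> \<infinity>"
      using config_finite[OF T_configs[OF \<omega>] bounded_borel_Int(2)[OF \<Lambda> sets_Pair2[OF S]], of \<omega>]
      by (simp add: less_le)
    ultimately show ?thesis
      using sets_Pair2[OF S] \<Lambda> by (simp add: emeasure_Diff sets_config[OF T_configs[OF \<omega>]])
  qed
  then show ?case
    by (rule measurable_cong[THEN iffD2]) (use compl(2) in simp_all)
next
  case (union S)
  have S: "S i \<in> sets (borel \<Otimes>\<^sub>M M)" for i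
    using union(2) by (auto simp: sets_pair_measure)
  have \<Lambda>': "\<Lambda> \<in> sets borel"
    using \<Lambda> by auto
  have "emeasure (T \<omega>) (\<Lambda> \<inter> (\<lambda>x. (x, \<omega>)) -` (\<Union>i. S i)) =
      (\<Sum>i. emeasure (T \<omega>) (\<Lambda> \<inter> (\<lambda>x. (x, \<omega>)) -` S i))" if \<omega>: "\<omega> \<in> space M" for \<omega>
  proof (subst suminf_emeasure)
    show "range (\<lambda>i. \<Lambda> \<inter> (\<lambda>x. (x, \<omega>)) -` S i) \<subseteq> sets (T \<omega>)"
      using sets_Pair2[OF S] \<Lambda>' by (auto simp: sets_config[OF T_configs[OF \<omega>]])
    show "disjoint_family (\<lambda>i. \<Lambda> \<inter> (\<lambda>x. (x, \<omega>)) -` S i)"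
      using union(1) unfolding disjoint_family_on_def by blast
    show "emeasure (T \<omega>) (\<Lambda> \<inter> (\<lambda>x. (x, \<omega>)) -` (\<Union>i. S i)) =
        emeasure (T \<omega>) (\<Union>i. \<Lambda> \<inter> (\<lambda>x. (x, \<omega>)) -` S i)"
      by (rule arg_cong[where f="emeasure (T \<omega>)"]) blast
  qed
  then show ?case
    by (rule measurable_cong[THEN iffD2]) (use union(3) in simp_all)
qed

lemma measurable_emeasure_section:
  assumes S: "S \<in> sets (borel \<Otimes>\<^sub>M M)"
  shows "(\<lambda>\<omega>. emeasure (T \<omega>) ((\<lambda>x. (x, \<omega>)) -` S)) \<in> borel_measurable M"
proof -
  have "(\<lambda>\<omega>. SUP n::nat. emeasure (T \<omega>) (ball 0 (real n) \<inter> (\<lambda>x. (x, \<omega>)) -` S)) \<in> borel_measurable M"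
    using S by (intro borel_measurable_SUP measurable_emeasure_section_bounded) auto
  then show ?thesis
    using sets_Pair2[OF S] by (subst measurable_cong[OF emeasure_config_SUP[OF T_configs]]) (auto simp: Int_commute)
qed

text \<open>The integrating measure varies with \<omega> and is in general infinite. Measurability
  of Campbell sums, of the relation x \<in> \<gamma> and of \<open>del_pt\<close> and
  \<open>ins_pt\<close> all rest on this.\<close>

lemma measurable_nn_integral_config:
  assumes "g \<in> borel_measurable (borel \<Otimes>\<^sub>M M)"
  shows "(\<lambda>\<omega>. \<integral>\<^sup>+x. g (x, \<omega>) \<partial>T \<omega>) \<in> borel_measurable M"
proof -
  have sec: "(\<lambda>x. u (x, \<omega>)) \<in> borel_measurable (T \<omega>)"
    if "u \<in> borel_measurable (borel \<Otimes>\<^sub>M M)" "\<omega> \<in> space M" for u :: "'a \<times> 'b \<Rightarrow> ennreal" and \<omega>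
    using that measurable_compose[OF measurable_Pair2'[OF that(2)] that(1)]
    by (simp add: measurable_cong_sets[OF sets_config[OF T_configs[OF that(2)]] refl])
  show ?thesis
    using assms
  proof (induction g rule: borel_measurable_induct)
    case (cong f g)
    then have "(\<integral>\<^sup>+x. f (x, \<omega>) \<partial>T \<omega>) = (\<integral>\<^sup>+x. g (x, \<omega>) \<partial>T \<omega>)" if "\<omega> \<in> space M" for \<omega>
      using that by (intro nn_integral_cong) (auto simp: space_pair_measure)
    with cong show ?case
      by (subst measurable_cong[where g="\<lambda>\<omega>. \<integral>\<^sup>+x. g (x, \<omega>) \<partial>T \<omega>"]) auto
  next
    case (set S)
    have "(\<integral>\<^sup>+x. indicator S (x, \<omega>) \<partial>T \<omega>) = emeasure (T \<omega>) ((\<lambda>x. (x, \<omega>)) -` S)" if "\<omega> \<in> space M" for \<omega>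
    proof -
      have "(\<integral>\<^sup>+x. indicator S (x, \<omega>) \<partial>T \<omega>) = (\<integral>\<^sup>+x. indicator ((\<lambda>x. (x, \<omega>)) -` S) x \<partial>T \<omega>)"
        by (intro nn_integral_cong) (auto split: split_indicator)
      also have "\<dots> = emeasure (T \<omega>) ((\<lambda>x. (x, \<omega>)) -` S)"
        using sets_Pair2[OF set] by (intro nn_integral_indicator) (simp add: sets_config[OF T_configs[OF that]])
      finally show ?thesis .
    qed
    then show ?case
      by (rule measurable_cong[THEN iffD2, OF _ measurable_emeasure_section[OF set]])
  next
    case (mult u c)
    then show ?case
      by (subst measurable_cong[where g="\<lambda>\<omega>. c * (\<integral>\<^sup>+x. u (x, \<omega>) \<partial>T \<omega>)"])
         (auto intro!: nn_integral_cmult sec)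
  next
    case (add u v)
    then show ?case
      by (subst measurable_cong[where g="\<lambda>\<omega>. (\<integral>\<^sup>+x. v (x, \<omega>) \<partial>T \<omega>) + (\<integral>\<^sup>+x. u (x, \<omega>) \<partial>T \<omega>)"])
         (auto intro!: nn_integral_add sec)
  next
    case (seq U)
    have "(\<integral>\<^sup>+x. (SUP i. U i) (x, \<omega>) \<partial>T \<omega>) = (SUP i. \<integral>\<^sup>+x. U i (x, \<omega>) \<partial>T \<omega>)" if "\<omega> \<in> space M" for \<omega>
      unfolding SUP_apply using seq(3) that
      by (intro nn_integral_monotone_convergence_SUP sec seq(1)) (auto simp: incseq_def le_fun_def)
    then show ?case
      by (rule measurable_cong[THEN iffD2]) (use seq in \<open>auto intro: borel_measurable_SUP\<close>)
  qed
qed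

lemma measurable_points [measurable (raw)]:
  assumes [measurable]: "f \<in> borel_measurable M"
  shows "Measurable.pred M (\<lambda>\<omega>. f \<omega> \<in> points (T \<omega>))"
proof -
  \<comment> \<open>Membership is read off from the mass of the section of a graph: the one-point
    set at \<open>f \<omega>\<close> has mass 1 or 0 according to whether it is a point of
    \<open>T \<omega>\<close>.\<close>
  have "(\<lambda>\<omega>. \<integral>\<^sup>+y. indicator {z. fst z = f (snd z)} (y, \<omega>) \<partial>T \<omega>) \<in> borel_measurable M"
    by (rule measurable_nn_integral_config) measurable
  moreover have "(\<integral>\<^sup>+y. indicator {z. fst z = f (snd z)} (y, \<omega>) \<partial>T \<omega>) = indicator (points (T \<omega>)) (f \<omega>)"
    if "\<omega> \<in> space M" for \<omega>
  proof -
    have "(\<integral>\<^sup>+y. indicator {z. fst z = f (snd z)} (y, \<omega>) \<partial>T \<omega>) = (\<integral>\<^sup>+y. indicator {f \<omega>} y \<partial>T \<omega>)"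
      by (intro nn_integral_cong) (auto split: split_indicator)
    also have "\<dots> = emeasure (T \<omega>) {f \<omega>}"
      by (intro nn_integral_indicator) (simp add: sets_config[OF T_configs[OF that]])
    finally show ?thesis
      by (simp add: emeasure_config_singleton[OF T_configs[OF that]])
  qed
  ultimately have [measurable]: "(\<lambda>\<omega>. indicator (points (T \<omega>)) (f \<omega>) :: ennreal) \<in> borel_measurable M"
    by (rule measurable_cong[THEN iffD1, rotated])
  have "Measurable.pred M (\<lambda>\<omega>. (indicator (points (T \<omega>)) (f \<omega>) :: ennreal) = 1)"
    by measurable
  also have "(\<lambda>\<omega>. (indicator (points (T \<omega>)) (f \<omega>) :: ennreal) = 1) = (\<lambda>\<omega>. f \<omega> \<in> points (T \<omega>))"
    by (auto simp: fun_eq_iff indicator_def)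
  finally show ?thesis .
qed

lemma measurable_emeasure_Diff_pt:
  assumes [measurable]: "f \<in> borel_measurable M" "\<Lambda> \<in> sets borel"
  shows "(\<lambda>\<omega>. emeasure (T \<omega>) (\<Lambda> - {f \<omega>})) \<in> borel_measurable M"
proof -
  have "(\<lambda>\<omega>. \<integral>\<^sup>+y. indicator {z. fst z \<in> \<Lambda> \<and> fst z \<noteq> f (snd z)} (y, \<omega>) \<partial>T \<omega>) \<in> borel_measurable M"
    by (rule measurable_nn_integral_config) measurable
  moreover have "(\<integral>\<^sup>+y. indicator {z. fst z \<in> \<Lambda> \<and> fst z \<noteq> f (snd z)} (y, \<omega>) \<partial>T \<omega>) =
      emeasure (T \<omega>) (\<Lambda> - {f \<omega>})"
    if "\<omega> \<in> space M" for \<omega>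
  proof -
    have "(\<integral>\<^sup>+y. indicator {z. fst z \<in> \<Lambda> \<and> fst z \<noteq> f (snd z)} (y, \<omega>) \<partial>T \<omega>) =
        (\<integral>\<^sup>+y. indicator (\<Lambda> - {f \<omega>}) y \<partial>T \<omega>)"
      by (intro nn_integral_cong) (auto split: split_indicator)
    also have "\<dots> = emeasure (T \<omega>) (\<Lambda> - {f \<omega>})"
      by (intro nn_integral_indicator) (simp add: sets_config[OF T_configs[OF that]])
    finally show ?thesis .
  qed
  ultimately show ?thesis
    by (rule measurable_cong[THEN iffD1, rotated])
qed

lemma measurable_del_pt [measurable (raw)]:
  assumes f: "f \<in> borel_measurable M"
  shows "(\<lambda>\<omega>. del_pt (f \<omega>) (T \<omega>)) \<in> measurable M config_space"
proof (rule measurable_configI)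
  fix \<Lambda> :: "'a set" assume "\<Lambda> \<in> bounded_borel"
  then have "\<Lambda> \<in> sets borel" by auto
  then show "(\<lambda>\<omega>. emeasure (del_pt (f \<omega>) (T \<omega>)) \<Lambda>) \<in> borel_measurable M"
    using measurable_emeasure_Diff_pt[OF f]
    by (subst measurable_cong[OF emeasure_del_pt]) (auto simp: sets_config[OF T_configs])
qed (simp add: del_pt_configs T_configs)

lemma measurable_ins_pt [measurable (raw)]:
  assumes f: "f \<in> borel_measurable M"
  shows "(\<lambda>\<omega>. ins_pt (f \<omega>) (T \<omega>)) \<in> measurable M config_space"
proof (rule measurable_configI)
  fix \<Lambda> :: "'a set" assume "\<Lambda> \<in> bounded_borel"
  then have "\<Lambda> \<in> sets borel" by auto
  moreover from this have "(\<lambda>\<omega>. indicator \<Lambda> (f \<omega>) :: ennreal) \<in> borel_measurable M"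
    using f by simp
  ultimately show "(\<lambda>\<omega>. emeasure (ins_pt (f \<omega>) (T \<omega>)) \<Lambda>) \<in> borel_measurable M"
    using measurable_emeasure_Diff_pt[OF f]
    by (subst measurable_cong[OF emeasure_ins_pt]) (auto simp: sets_config[OF T_configs])
qed (simp add: ins_pt_configs T_configs)

lemma measurable_glue [measurable (raw)]:
  assumes T'[measurable]: "T' \<in> measurable M config_space" and [measurable]: "\<Lambda> \<in> sets borel"
  shows "(\<lambda>\<omega>. glue \<Lambda> (T' \<omega>) (T \<omega>)) \<in> measurable M config_space"
proof (rule measurable_configI)
  have T'_configs: "\<omega> \<in> space M \<Longrightarrow> T' \<omega> \<in> configs" for \<omega>
    using measurable_space[OF T'] by simp
  then show "glue \<Lambda> (T' \<omega>) (T \<omega>) \<in> configs" if "\<omega> \<in> space M" for \<omega>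
    using that by (simp add: glue_configs T_configs)
  fix A :: "'a set" assume "A \<in> bounded_borel"
  then have [measurable]: "A \<in> sets borel" by auto
  have "(\<lambda>\<omega>. emeasure (T' \<omega>) (A \<inter> \<Lambda>) + emeasure (T \<omega>) (A - \<Lambda>)) \<in> borel_measurable M"
    by measurable
  then show "(\<lambda>\<omega>. emeasure (glue \<Lambda> (T' \<omega>) (T \<omega>)) A) \<in> borel_measurable M"
    by (subst measurable_cong[OF emeasure_glue]) (auto simp: T_configs T'_configs)
qed

end

subsection \<open>The reduced Campbell measure\<close>

lemma measurable_campbell_integrand:
  assumes g [measurable]: "g \<in> borel_measurable (borel \<Otimes>\<^sub>M config_space)" and \<gamma>: "\<gamma> \<in> configs"
  shows "(\<lambda>x. g (x, del_pt x \<gamma>)) \<in> borel_measurable \<gamma>"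
proof -
  have [measurable]: "(\<lambda>_. \<gamma>) \<in> measurable borel config_space"
    using \<gamma> by simp
  have "(\<lambda>x. g (x, del_pt x \<gamma>)) \<in> borel_measurable borel"
    by measurable
  then show ?thesis
    by (simp add: measurable_cong_sets[OF sets_config[OF \<gamma>] refl])
qed

context
  fixes \<mu> :: "'a::euclidean_space measure measure"
  assumes \<mu> [measurable_cong]: "sets \<mu> = sets config_space"
begin

lemma space_law: "space \<mu> = configs"
  using sets_eq_imp_space_eq[OF \<mu>] by simp

text \<open>Here one configuration is both the integrating measure and the parameter, so the
  previous result is applied with the identity as \<open>T\<close>.\<close>

lemma measurable_campbell_inner:
  assumes g [measurable]: "g \<in> borel_measurable (borel \<Otimes>\<^sub>M config_space)"
  shows "(\<lambda>\<gamma>. \<integral>\<^sup>+x. g (x, del_pt x \<gamma>) \<partial>\<gamma>) \<in> borel_measurable \<mu>"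
proof -
  have "(\<lambda>z. g (fst z, del_pt (fst z) (snd z))) \<in> borel_measurable (borel \<Otimes>\<^sub>M config_space)"
    by measurable
  then have "(\<lambda>z. g (fst z, del_pt (fst z) (snd z))) \<in> borel_measurable (borel \<Otimes>\<^sub>M \<mu>)"
    by (simp add: measurable_cong_sets[OF sets_pair_measure_cong[OF refl \<mu>] refl])
  then show ?thesis
    using measurable_nn_integral_config[OF measurable_ident_sets[OF \<mu>], of "\<lambda>z. g (fst z, del_pt (fst z) (snd z))"]
    by simp
qed

lemma sets_reduced_campbell [simp, measurable_cong]:
  "sets (reduced_campbell \<mu>) = sets (borel \<Otimes>\<^sub>M config_space)"
  unfolding reduced_campbell_def by (intro sets.sets_measure_of_eq)

lemma measurable_reduced_campbell:
  "g \<in> measurable (borel \<Otimes>\<^sub>M config_space) N \<Longrightarrow> g \<in> measurable (reduced_campbell \<mu>) N"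
  by (simp add: measurable_cong_sets[OF sets_reduced_campbell refl])

text \<open>\<open>measure_of\<close> returns the prescribed values only if they are countably
  additive. Once \<open>diff_measure\<close> is replaced \<gamma>-almost everywhere by
  \<open>del_pt\<close>, the integrands are measurable, and additivity amounts to interchanging the
  sum with both integrals.\<close>

lemma emeasure_reduced_campbell:
  assumes A: "A \<in> sets (borel \<Otimes>\<^sub>M config_space)"
  shows "emeasure (reduced_campbell \<mu>) A = (\<integral>\<^sup>+\<gamma>. \<integral>\<^sup>+x. indicator A (x, del_pt x \<gamma>) \<partial>\<gamma> \<partial>\<mu>)"
proof -
  let ?N = "borel \<Otimes>\<^sub>M config_space :: ('a \<times> 'a measure) measure"
  define m where "m A = (\<integral>\<^sup>+\<gamma>. \<integral>\<^sup>+x. indicator A (x, del_pt x \<gamma>) \<partial>\<gamma> \<partial>\<mu>)" for A :: "('a \<times> 'a measure) set"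
  have "(\<integral>\<^sup>+\<gamma>. \<integral>\<^sup>+x. indicator A (x, diff_measure \<gamma> (return borel x)) \<partial>\<gamma> \<partial>\<mu>) = m A" for A
    unfolding m_def
  proof (rule nn_integral_cong)
    fix \<gamma> assume "\<gamma> \<in> space \<mu>"
    then have \<gamma>: "\<gamma> \<in> configs" by (simp add: space_law)
    show "(\<integral>\<^sup>+x. indicator A (x, diff_measure \<gamma> (return borel x)) \<partial>\<gamma>) =
        (\<integral>\<^sup>+x. indicator A (x, del_pt x \<gamma>) \<partial>\<gamma>)"
      using AE_in_points[OF \<gamma>]
      by (intro nn_integral_cong_AE, eventually_elim) (simp add: diff_measure_return_eq_del_pt[OF \<gamma>])
  qed
  then have eq: "reduced_campbell \<mu> = measure_of (space ?N) (sets ?N) m"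
    unfolding reduced_campbell_def by simp
  have "emeasure (measure_of (space ?N) (sets ?N) m) A = m A"
  proof (rule emeasure_measure_of_sigma[OF sets.sigma_algebra_axioms _ _ A])
    show "positive (sets ?N) m"
      by (simp add: positive_def m_def)
    show "countably_additive (sets ?N) m"
    proof (rule countably_additiveI)
      fix B :: "nat \<Rightarrow> ('a \<times> 'a measure) set"
      assume B: "range B \<subseteq> sets ?N" and disj: "disjoint_family B"
      have [measurable]: "\<And>i. B i \<in> sets ?N" using B by auto
      have "(\<Sum>i. m (B i)) = (\<integral>\<^sup>+\<gamma>. (\<Sum>i. \<integral>\<^sup>+x. indicator (B i) (x, del_pt x \<gamma>) \<partial>\<gamma>) \<partial>\<mu>)"
        unfolding m_def by (intro nn_integral_suminf[symmetric] measurable_campbell_inner) measurable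
      also have "\<dots> = (\<integral>\<^sup>+\<gamma>. \<integral>\<^sup>+x. (\<Sum>i. indicator (B i) (x, del_pt x \<gamma>)) \<partial>\<gamma> \<partial>\<mu>)"
        by (intro nn_integral_cong nn_integral_suminf[symmetric] measurable_campbell_integrand)
           (auto simp: space_law)
      also have "\<dots> = m (\<Union>i. B i)"
        unfolding m_def by (intro nn_integral_cong suminf_indicator disj)
      finally show "(\<Sum>i. m (B i)) = m (\<Union>i. B i)" .
    qed
  qed
  then show ?thesis
    unfolding eq m_def .
qed

text \<open>The point x is drawn from the very configuration that it is removed from, so this is no
  integral over a product measure. The formula is lifted from sets to functions, each rule of
  integration being used once for \<gamma> and once for \<mu>.\<close>

lemma nn_integral_reduced_campbell:
  assumes "g \<in> borel_measurable (borel \<Otimes>\<^sub>M config_space)"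
  shows "(\<integral>\<^sup>+z. g z \<partial>reduced_campbell \<mu>) = (\<integral>\<^sup>+\<gamma>. \<integral>\<^sup>+x. g (x, del_pt x \<gamma>) \<partial>\<gamma> \<partial>\<mu>)"
  using assms
proof (induction g rule: borel_measurable_induct)
  case (cong f g)
  have "(\<integral>\<^sup>+z. f z \<partial>reduced_campbell \<mu>) = (\<integral>\<^sup>+z. g z \<partial>reduced_campbell \<mu>)"
    using cong(3) by (intro nn_integral_cong) (simp add: sets_eq_imp_space_eq[OF sets_reduced_campbell])
  moreover have "(\<integral>\<^sup>+\<gamma>. \<integral>\<^sup>+x. f (x, del_pt x \<gamma>) \<partial>\<gamma> \<partial>\<mu>) = (\<integral>\<^sup>+\<gamma>. \<integral>\<^sup>+x. g (x, del_pt x \<gamma>) \<partial>\<gamma> \<partial>\<mu>)"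
    using cong(3) by (intro nn_integral_cong) (simp add: space_pair_measure space_law del_pt_configs)
  ultimately show ?case
    using cong(4) by simp
next
  case (set A)
  then show ?case
    using emeasure_reduced_campbell[OF set] by simp
next
  case (mult u c)
  have "(\<integral>\<^sup>+\<gamma>. \<integral>\<^sup>+x. c * u (x, del_pt x \<gamma>) \<partial>\<gamma> \<partial>\<mu>) = (\<integral>\<^sup>+\<gamma>. c * (\<integral>\<^sup>+x. u (x, del_pt x \<gamma>) \<partial>\<gamma>) \<partial>\<mu>)"
    using mult(2) by (intro nn_integral_cong nn_integral_cmult measurable_campbell_integrand) (auto simp: space_law)
  also have "\<dots> = c * (\<integral>\<^sup>+\<gamma>. \<integral>\<^sup>+x. u (x, del_pt x \<gamma>) \<partial>\<gamma> \<partial>\<mu>)"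
    using mult(2) by (intro nn_integral_cmult measurable_campbell_inner)
  finally show ?case
    using mult(2,4) by (simp add: nn_integral_cmult measurable_reduced_campbell)
next
  case (add u v)
  have "(\<integral>\<^sup>+\<gamma>. \<integral>\<^sup>+x. v (x, del_pt x \<gamma>) + u (x, del_pt x \<gamma>) \<partial>\<gamma> \<partial>\<mu>) =
      (\<integral>\<^sup>+\<gamma>. (\<integral>\<^sup>+x. v (x, del_pt x \<gamma>) \<partial>\<gamma>) + (\<integral>\<^sup>+x. u (x, del_pt x \<gamma>) \<partial>\<gamma>) \<partial>\<mu>)"
    using add(1,3) by (intro nn_integral_cong nn_integral_add measurable_campbell_integrand) (auto simp: space_law)
  also have "\<dots> = (\<integral>\<^sup>+\<gamma>. \<integral>\<^sup>+x. v (x, del_pt x \<gamma>) \<partial>\<gamma> \<partial>\<mu>) + (\<integral>\<^sup>+\<gamma>. \<integral>\<^sup>+x. u (x, del_pt x \<gamma>) \<partial>\<gamma> \<partial>\<mu>)"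
    using add(1,3) by (intro nn_integral_add measurable_campbell_inner)
  finally show ?case
    using add by (simp add: nn_integral_add measurable_reduced_campbell)
next
  case (seq U)
  have "(\<integral>\<^sup>+\<gamma>. \<integral>\<^sup>+x. (SUP i. U i) (x, del_pt x \<gamma>) \<partial>\<gamma> \<partial>\<mu>) =
      (\<integral>\<^sup>+\<gamma>. (SUP i. \<integral>\<^sup>+x. U i (x, del_pt x \<gamma>) \<partial>\<gamma>) \<partial>\<mu>)"
    unfolding SUP_apply using seq(3)
    by (intro nn_integral_cong nn_integral_monotone_convergence_SUP measurable_campbell_integrand seq(1))
       (auto simp: space_law incseq_def le_fun_def)
  also have "\<dots> = (SUP i. \<integral>\<^sup>+\<gamma>. \<integral>\<^sup>+x. U i (x, del_pt x \<gamma>) \<partial>\<gamma> \<partial>\<mu>)"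
    using seq(3)
    by (intro nn_integral_monotone_convergence_SUP measurable_campbell_inner seq(1))
       (auto simp: incseq_def le_fun_def intro!: nn_integral_mono)
  also have "\<dots> = (SUP i. \<integral>\<^sup>+z. U i z \<partial>reduced_campbell \<mu>)"
    using seq.IH by simp
  also have "\<dots> = (\<integral>\<^sup>+z. (SUP i. U i z) \<partial>reduced_campbell \<mu>)"
    using seq(1,3) by (intro nn_integral_monotone_convergence_SUP[symmetric] measurable_reduced_campbell) auto
  finally show ?case
    by (simp add: image_image)
qed

end

subsection \<open>Poisson processes\<close>

text \<open>The witness consists of the atoms of the generated ring of sets, indexed by the subfamilies
  that contain a given point.\<close>
lemma bounded_borel_atoms:
  assumes fin: "finite \<B>" and \<B>: "\<B> \<subseteq> bounded_borel"
  obtains \<C> where "finite \<C>" "\<C> \<subseteq> bounded_borel" "disjoint \<C>"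
    "\<forall>B\<in>\<B>. B = \<Union>{C \<in> \<C>. C \<subseteq> B}"
proof -
  define lab where "lab x = {B \<in> \<B>. x \<in> B}" for x
  \<comment> \<open>The empty label is left out, because its atom is the unbounded complement of all
    members of \<B>.\<close>
  define \<C> where "\<C> = (\<lambda>J. {x. lab x = J}) ` (Pow \<B> - {{}})"
  show ?thesis
  proof (rule that)
    show "finite \<C>"
      unfolding \<C>_def using fin by simp
    show "disjoint \<C>"
      unfolding \<C>_def disjoint_def by auto
    show "\<C> \<subseteq> bounded_borel"
    proof
      fix C assume "C \<in> \<C>"
      then obtain J B where C: "C = {x. lab x = J}" and J: "J \<subseteq> \<B>" "B \<in> J"
        unfolding \<C>_def by blast
      have "C = (\<Inter>B\<in>\<B>. if B \<in> J then B else - B)"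
        using J(1) by (auto simp: C lab_def split: if_splits)
      moreover have "(\<Inter>B\<in>\<B>. if B \<in> J then B else - B) \<in> sets borel"
        using fin J \<B> by (intro sets.finite_INT) (auto intro: borel_comp)
      ultimately have "C \<in> sets borel" by simp
      moreover have "C \<subseteq> B"
        using J by (auto simp: C lab_def)
      moreover have "B \<in> bounded_borel"
        using J \<B> by blast
      ultimately show "C \<in> bounded_borel"
        by (auto simp: bounded_borel_def intro: bounded_subset)
    qed
    show "\<forall>B\<in>\<B>. B = \<Union>{C \<in> \<C>. C \<subseteq> B}"
    proof (intro ballI equalityI subsetI)
      fix B assume B: "B \<in> \<B>"
      fix x assume x: "x \<in> B"
      have "{y. lab y = lab x} \<in> \<C>"
        unfolding \<C>_def using x B by (intro imageI) (auto simp: lab_def)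
      moreover have "{y. lab y = lab x} \<subseteq> B"
        using x B by (auto simp: lab_def)
      ultimately show "x \<in> \<Union>{C \<in> \<C>. C \<subseteq> B}"
        by (intro UnionI[of "{y. lab y = lab x}"]) auto
    qed auto
  qed
qed

text \<open>Indexed by sets of constraints: intersecting two cylinders means uniting their
  constraints, and no constraint at all gives \<open>configs\<close>. Contradictory constraints are
  allowed and give the empty event.\<close>

definition cylinder :: "('a::euclidean_space set \<times> nat) set \<Rightarrow> 'a measure set" where
  "cylinder Z = {\<gamma> \<in> configs. \<forall>(B, k)\<in>Z. emeasure \<gamma> B = of_nat k}"

lemma cylinder_in_sets:
  assumes "finite Z" "Z \<subseteq> bounded_borel \<times> UNIV"
  shows "cylinder Z \<in> sets config_space"
proof -
  have "cylinder Z = (\<Inter>(B, k)\<in>Z. {\<gamma> \<in> configs. emeasure \<gamma> B = of_nat k}) \<inter> configs"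
    by (auto simp: cylinder_def)
  moreover have "{\<gamma> \<in> configs. emeasure \<gamma> B = of_nat k} \<in> sets config_space"
    if "(B, k) \<in> Z" for B and k
    using assms(2) that unfolding sets_config_space by (intro sigma_sets.Basic) blast
  moreover have "configs \<in> sets config_space"
    using sets.top[of config_space] by simp
  ultimately show ?thesis
    using assms(1) by (cases "Z = {}") (auto intro!: sets.Int sets.finite_INT)
qed

lemma sets_config_space_cylinder:
  "sets (config_space :: 'a::euclidean_space measure measure) = sigma_sets configs {cylinder Z | Z. finite Z \<and> Z \<subseteq> bounded_borel \<times> UNIV}"
  (is "_ = sigma_sets _ ?E")
proof (intro equalityI)
  show "sets config_space \<subseteq> sigma_sets configs ?E"
    unfolding sets_config_space
  proof (rule sigma_sets_mono', rule subsetI)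
    fix Y assume "Y \<in> {{\<gamma> \<in> configs. emeasure \<gamma> \<Lambda> = of_nat n} | \<Lambda> n. \<Lambda> \<in> (bounded_borel :: 'a set set)}"
    then obtain \<Lambda> and n :: nat where "Y = {\<gamma> \<in> configs. emeasure \<gamma> \<Lambda> = of_nat n}" "\<Lambda> \<in> bounded_borel"
      by blast
    then show "Y \<in> ?E"
      by (intro CollectI exI[of _ "{(\<Lambda>, n)}"]) (auto simp: cylinder_def)
  qed
  have "?E \<subseteq> sets config_space"
    using cylinder_in_sets by auto
  from sets.sigma_sets_subset[OF this]
  show "sigma_sets configs ?E \<subseteq> sets config_space"
    by simp
qed

lemma sets_borel_bounded_borel: "sets borel = sigma_sets UNIV (bounded_borel :: 'a::euclidean_space set set)"
proof (intro equalityI subsetI)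
  fix A :: "'a set" assume "A \<in> sets borel"
  then have "(\<Union>n::nat. A \<inter> ball 0 (real n)) \<in> sigma_sets UNIV bounded_borel"
    by (intro sigma_sets.Union sigma_sets.Basic) auto
  also have "(\<Union>n::nat. A \<inter> ball 0 (real n)) = A"
    unfolding Int_UN_distrib[symmetric] UN_ball_nat by simp
  finally show "A \<in> sigma_sets UNIV bounded_borel" .
next
  fix A :: "'a set" assume "A \<in> sigma_sets UNIV bounded_borel"
  then show "A \<in> sets borel"
    using sets.sigma_sets_subset[of "bounded_borel :: 'a set set" borel] by auto
qed

lemma sets_borel_config_space_rectangles:
  "sets (borel \<Otimes>\<^sub>M config_space :: ('a::euclidean_space \<times> 'a measure) measure) =
    sigma_sets (UNIV \<times> configs)
      {A \<times> cylinder Z | A Z. A \<in> bounded_borel \<and> finite Z \<and> Z \<subseteq> bounded_borel \<times> UNIV}"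
proof -
  let ?Eb = "{cylinder Z | Z. finite Z \<and> Z \<subseteq> (bounded_borel :: 'a set set) \<times> UNIV}"
  have "cylinder ({} :: ('a set \<times> nat) set) = configs"
    by (simp add: cylinder_def)
  then have conf: "configs \<in> ?Eb"
    by (intro CollectI exI[of _ "{}"]) auto
  \<comment> \<open>Products of generators generate the product \<sigma>-algebra because each factor
    is covered by countably many of its generators: the balls, and the single set
    \<open>configs\<close>.\<close>
  have "sets (borel \<Otimes>\<^sub>M config_space :: ('a \<times> 'a measure) measure) =
      sets (sigma (space borel \<times> space config_space) {a \<times> b | a b. a \<in> bounded_borel \<and> b \<in> ?Eb})"
  proof (rule sets_pair_eq)
    show "\<Union>(range (\<lambda>n::nat. ball (0::'a) (real n))) = space borel"
      by (simp add: UN_ball_nat)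
    show "sets borel = sigma_sets (space borel) (bounded_borel :: 'a set set)"
      using sets_borel_bounded_borel by simp
    show "sets config_space = sigma_sets (space config_space) ?Eb"
      using sets_config_space_cylinder by simp
    show "countable {configs :: 'a measure set}" "\<Union>{configs :: 'a measure set} = space config_space"
      by simp_all
    show "{configs} \<subseteq> ?Eb"
      using conf by simp
  qed (auto simp: cylinder_def)
  also have "\<dots> = sigma_sets (UNIV \<times> configs) {a \<times> b | a b. a \<in> bounded_borel \<and> b \<in> ?Eb}"
    by (subst sets_measure_of) (auto simp: cylinder_def)
  also have "{a \<times> b | a b. a \<in> bounded_borel \<and> b \<in> ?Eb} =
      {A \<times> cylinder Z | A Z. A \<in> bounded_borel \<and> finite Z \<and> Z \<subseteq> bounded_borel \<times> UNIV}"
    by auto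
  finally show ?thesis .
qed

section \<open>The Mecke equation for a Poisson process\<close>

context
  fixes \<rho> :: "'a::euclidean_space measure" and P :: "'a measure measure"
  assumes sets_\<rho> [measurable_cong]: "sets \<rho> = sets borel"
    and \<rho>_finite: "\<And>A. A \<in> bounded_borel \<Longrightarrow> emeasure \<rho> A < \<infinity>"
    and P: "poisson_process \<rho> P"
begin

lemma prob_space_P: "prob_space P"
  using P by (simp add: poisson_process_def)

lemma sets_P [measurable_cong]: "sets P = sets config_space"
  using P by (simp add: poisson_process_def)

lemma poisson_counts:
  assumes \<C>: "finite \<C>" "\<C> \<subseteq> bounded_borel" "disjoint \<C>"
  shows "emeasure P {\<gamma> \<in> configs. \<forall>C\<in>\<C>. emeasure \<gamma> C = of_nat (n C)} =
    ennreal (\<Prod>C\<in>\<C>. measure \<rho> C ^ n C / fact (n C) * exp (- measure \<rho> C))"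
proof -
  interpret P: prob_space P by (rule prob_space_P)
  have spP: "space P = configs"
    using sets_eq_imp_space_eq[OF sets_P] by simp
  show ?thesis
  proof (cases "\<C> = {}")
    case True
    then show ?thesis
      using P.emeasure_space_1 by (simp add: spP)
  next
    case False
    \<comment> \<open>Independence is given for families indexed by natural numbers, so \<C> is
      enumerated. The empty family was split off because the product rule asks for a nonempty index
      set.\<close>
    obtain h where h: "bij_betw h {0..<card \<C>} \<C>"
      using ex_bij_betw_nat_finite[OF \<C>(1)] by blast
    then have h_in: "h i \<in> \<C>" if "i < card \<C>" for i
      using that by (auto simp: bij_betw_def)
    have img: "h ` {0..<card \<C>} = \<C>"
      using h by (simp add: bij_betw_def)
    have "disjoint_family_on h {0..<card \<C>}"
    proof (unfold disjoint_family_on_def, intro ballI impI)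
      fix i j assume ij: "i \<in> {0..<card \<C>}" "j \<in> {0..<card \<C>}" "i \<noteq> j"
      then have "h i \<noteq> h j"
        using h by (auto simp: bij_betw_def dest: inj_onD)
      with ij show "h i \<inter> h j = {}"
        using disjointD[OF \<C>(3)] h_in by simp
    qed
    moreover have "\<forall>i\<in>{0..<card \<C>}. h i \<in> bounded_borel"
      using h_in \<C>(2) by auto
    ultimately have ind: "P.indep_vars (\<lambda>_. borel) (\<lambda>i \<gamma>. emeasure \<gamma> (h i)) {0..<card \<C>}"
      using P by (simp add: poisson_process_def)
    have ne: "{0..<card \<C>} \<noteq> {}"
      using False \<C>(1) by (simp add: card_gt_0_iff)
    have "{\<gamma> \<in> configs. \<forall>C\<in>h ` {0..<card \<C>}. emeasure \<gamma> C = of_nat (n C)} =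
        (\<Inter>i\<in>{0..<card \<C>}. (\<lambda>\<gamma>. emeasure \<gamma> (h i)) -` {of_nat (n (h i))} \<inter> space P)"
      using ne by (auto simp: spP)
    then have "measure P {\<gamma> \<in> configs. \<forall>C\<in>\<C>. emeasure \<gamma> C = of_nat (n C)} =
        measure P (\<Inter>i\<in>{0..<card \<C>}. (\<lambda>\<gamma>. emeasure \<gamma> (h i)) -` {of_nat (n (h i))} \<inter> space P)"
      unfolding img by (rule arg_cong)
    also have "\<dots> = (\<Prod>i\<in>{0..<card \<C>}. measure P ((\<lambda>\<gamma>. emeasure \<gamma> (h i)) -` {of_nat (n (h i))} \<inter> space P))"
      using ne by (intro P.indep_varsD_finite[OF ind]) auto
    also have "\<dots> = (\<Prod>i\<in>{0..<card \<C>}. measure \<rho> (h i) ^ n (h i) / fact (n (h i)) * exp (- measure \<rho> (h i)))"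
    proof (rule prod.cong[OF refl])
      fix i assume i: "i \<in> {0..<card \<C>}"
      have "(\<lambda>\<gamma>. emeasure \<gamma> (h i)) -` {of_nat (n (h i))} \<inter> space P =
          {\<gamma> \<in> space P. emeasure \<gamma> (h i) = of_nat (n (h i))}"
        by auto
      then show "measure P ((\<lambda>\<gamma>. emeasure \<gamma> (h i)) -` {of_nat (n (h i))} \<inter> space P) =
          measure \<rho> (h i) ^ n (h i) / fact (n (h i)) * exp (- measure \<rho> (h i))"
        using P h_in[of i] \<C>(2) i by (auto simp: poisson_process_def)
    qed
    also have "\<dots> = (\<Prod>C\<in>\<C>. measure \<rho> C ^ n C / fact (n C) * exp (- measure \<rho> C))"
      by (rule prod.reindex_bij_betw[OF h])
    finally show ?thesis
      by (simp add: P.emeasure_eq_measure)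
  qed
qed

text \<open>By independence only the weight of \<open>C0\<close> changes, and (k + 1) r^(k + 1) / (k
  + 1)! = r r^k / k! for the mass r of \<open>C0\<close> and its count k. This includes r =
  0.\<close>

lemma poisson_counts_Suc:
  assumes \<C>: "finite \<C>" "\<C> \<subseteq> bounded_borel" "disjoint \<C>" and C0: "C0 \<in> \<C>"
  shows "of_nat (Suc (n C0)) *
      emeasure P {\<gamma> \<in> configs. \<forall>C\<in>\<C>. emeasure \<gamma> C = of_nat ((n(C0 := Suc (n C0))) C)} =
    emeasure \<rho> C0 * emeasure P {\<gamma> \<in> configs. \<forall>C\<in>\<C>. emeasure \<gamma> C = of_nat (n C)}"
proof -
  let ?w = "\<lambda>C k. measure \<rho> C ^ k / fact k * exp (- measure \<rho> C)"
  have "real (Suc (n C0)) * (\<Prod>C\<in>\<C>. ?w C ((n(C0 := Suc (n C0))) C)) =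
      real (Suc (n C0)) * ?w C0 (Suc (n C0)) * (\<Prod>C\<in>\<C> - {C0}. ?w C (n C))"
    using \<C>(1) C0 by (subst prod.remove[OF _ C0]) (auto intro!: prod.cong)
  also have "real (Suc (n C0)) * ?w C0 (Suc (n C0)) = measure \<rho> C0 * ?w C0 (n C0)"
    by (simp add: field_simps del: of_nat_Suc)
  also have "measure \<rho> C0 * ?w C0 (n C0) * (\<Prod>C\<in>\<C> - {C0}. ?w C (n C)) =
      measure \<rho> C0 * (\<Prod>C\<in>\<C>. ?w C (n C))"
    by (simp add: prod.remove[OF \<C>(1) C0] mult.assoc)
  finally have eq: "real (Suc (n C0)) * (\<Prod>C\<in>\<C>. ?w C ((n(C0 := Suc (n C0))) C)) =
      measure \<rho> C0 * (\<Prod>C\<in>\<C>. ?w C (n C))" .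
  have "emeasure \<rho> C0 = ennreal (measure \<rho> C0)"
    using \<rho>_finite[of C0] C0 \<C>(2) by (intro emeasure_eq_ennreal_measure) auto
  then show ?thesis
    unfolding poisson_counts[OF \<C>] using eq
    by (simp add: ennreal_of_nat_eq_real_of_nat ennreal_mult''[symmetric] prod_nonneg del: of_nat_Suc fun_upd_apply)
qed

text \<open>Removing a point of \<open>C0\<close> lowers the count of \<open>C0\<close> by one and leaves the other counts alone.\<close>
lemma campbell_poisson_atom:
  assumes \<C>: "finite \<C>" "\<C> \<subseteq> bounded_borel" "disjoint \<C>" and C0: "C0 \<in> \<C>"
  defines "D \<equiv> \<lambda>n::'a set \<Rightarrow> nat. {\<gamma> \<in> configs. \<forall>C\<in>\<C>. emeasure \<gamma> C = of_nat (n C)}"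
  shows "emeasure (reduced_campbell P) (C0 \<times> D n) = emeasure \<rho> C0 * emeasure P (D n)"
proof -
  let ?n = "n(C0 := Suc (n C0))"
  have C0_borel [measurable]: "C0 \<in> sets borel"
    using C0 \<C>(2) by auto
  have D_cyl: "D m = cylinder ((\<lambda>C. (C, m C)) ` \<C>)" for m
    by (auto simp: D_def cylinder_def)
  have D_sets [measurable]: "D m \<in> sets config_space" for m
    unfolding D_cyl using \<C> by (intro cylinder_in_sets) auto
  have "emeasure (reduced_campbell P) (C0 \<times> D n) =
      (\<integral>\<^sup>+\<gamma>. \<integral>\<^sup>+x. indicator (C0 \<times> D n) (x, del_pt x \<gamma>) \<partial>\<gamma> \<partial>P)"
    by (intro emeasure_reduced_campbell sets_P) measurable
  also have "\<dots> = (\<integral>\<^sup>+\<gamma>. of_nat (Suc (n C0)) * indicator (D ?n) \<gamma> \<partial>P)"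
  proof (rule nn_integral_cong)
    fix \<gamma> assume "\<gamma> \<in> space P"
    then have \<gamma>: "\<gamma> \<in> configs" by (simp add: space_law[OF sets_P])
    note [simp] = sets_config[OF \<gamma>]
    have "AE x in \<gamma>. indicator (C0 \<times> D n) (x, del_pt x \<gamma>) = (indicator (D ?n) \<gamma> * indicator C0 x :: ennreal)"
      using AE_in_points[OF \<gamma>]
    proof eventually_elim
      case (elim x)
      have "del_pt x \<gamma> \<in> D n \<longleftrightarrow> \<gamma> \<in> D ?n" if "x \<in> C0"
      proof -
        have "emeasure (del_pt x \<gamma>) C = of_nat (n C) \<longleftrightarrow> emeasure \<gamma> C = of_nat (?n C)" if C: "C \<in> \<C>" for C
        proof (cases "C = C0")
          case True
          have "emeasure \<gamma> C0 = emeasure \<gamma> ((C0 - {x}) \<union> {x})"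
            using \<open>x \<in> C0\<close> by (simp add: insert_absorb)
          also have "\<dots> = emeasure \<gamma> (C0 - {x}) + emeasure \<gamma> {x}"
            by (intro plus_emeasure[symmetric]) auto
          also have "emeasure \<gamma> {x} = 1"
            using elim by (simp add: emeasure_config_singleton[OF \<gamma>])
          finally show ?thesis
            using True by (simp add: emeasure_del_pt add.commute[of 1])
        next
          case False
          then have "C \<inter> C0 = {}"
            using C C0 \<C>(3) by (auto simp: disjoint_def)
          then have "C - {x} = C"
            using \<open>x \<in> C0\<close> by auto
          moreover have "C \<in> sets borel"
            using C \<C>(2) by auto
          ultimately show ?thesis
            using False by (simp add: emeasure_del_pt)
        qed
        then show ?thesis
          using \<gamma> by (simp add: D_def del_pt_configs del: fun_upd_apply)
      qed
      then show ?case
        by (auto simp: indicator_def)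
    qed
    then have "(\<integral>\<^sup>+x. indicator (C0 \<times> D n) (x, del_pt x \<gamma>) \<partial>\<gamma>) =
        (\<integral>\<^sup>+x. indicator (D ?n) \<gamma> * indicator C0 x \<partial>\<gamma>)"
      by (rule nn_integral_cong_AE)
    also have "\<dots> = indicator (D ?n) \<gamma> * emeasure \<gamma> C0"
      by (intro nn_integral_cmult_indicator) simp
    \<comment> \<open>On \<open>D ?n\<close> the set \<open>C0\<close> has \<open>Suc (n C0)\<close>
      points, and each of them is removed once.\<close>
    also have "\<dots> = of_nat (Suc (n C0)) * indicator (D ?n) \<gamma>"
      using C0 by (auto simp: D_def split: split_indicator)
    finally show "(\<integral>\<^sup>+x. indicator (C0 \<times> D n) (x, del_pt x \<gamma>) \<partial>\<gamma>) = of_nat (Suc (n C0)) * indicator (D ?n) \<gamma>" .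
  qed
  also have "\<dots> = of_nat (Suc (n C0)) * emeasure P (D ?n)"
    by (intro nn_integral_cmult_indicator) (simp add: sets_P)
  also have "\<dots> = emeasure \<rho> C0 * emeasure P (D n)"
    unfolding D_def by (rule poisson_counts_Suc[OF \<C> C0])
  finally show ?thesis .
qed

text \<open>\<open>A\<close> and the sets in \<open>Z\<close> may overlap, so they are refined
  together into disjoint atoms. The rectangle then splits into countably many disjoint products of
  one atom with one complete vector of counts, which the atomic case covers.\<close>

lemma campbell_poisson_rectangle:
  assumes A: "A \<in> bounded_borel" and Z: "finite Z" "Z \<subseteq> bounded_borel \<times> UNIV"
  shows "emeasure (reduced_campbell P) (A \<times> cylinder Z) = emeasure (\<rho> \<Otimes>\<^sub>M P) (A \<times> cylinder Z)"
proof -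
  interpret P: prob_space P by (rule prob_space_P)
  have "finite (insert A (fst ` Z))" "insert A (fst ` Z) \<subseteq> bounded_borel"
    using A Z by auto
  then obtain \<C> where \<C>: "finite \<C>" "\<C> \<subseteq> bounded_borel" "disjoint \<C>"
    and dec: "\<forall>B\<in>insert A (fst ` Z). B = \<Union>{C \<in> \<C>. C \<subseteq> B}"
    by (rule bounded_borel_atoms)
  define D where "D n = {\<gamma> \<in> configs. \<forall>C\<in>\<C>. emeasure \<gamma> C = of_nat (n C)}" for n :: "'a set \<Rightarrow> nat"
  \<comment> \<open>The count vectors on the atoms that are compatible with \<open>Z\<close>. Taking
    them extensional makes a vector determined by its values on \<C>: this gives countability, and
    distinct vectors describe disjoint events.\<close>
  define S where "S = {n \<in> PiE \<C> (\<lambda>_. UNIV :: nat set). \<forall>(B, k)\<in>Z. (\<Sum>C | C \<in> \<C> \<and> C \<subseteq> B. n C) = k}"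
  define I where "I = {C \<in> \<C>. C \<subseteq> A} \<times> S"
  define R where "R = (\<lambda>(C :: 'a set, n). C \<times> D n)"
  have "countable I"
    unfolding I_def S_def using \<C>(1)
    by (intro countable_SIGMA countable_subset[OF _ countable_PiE[OF \<C>(1), of "\<lambda>_. UNIV :: nat set"]])
       (auto intro: countable_finite)
  have D_cyl: "D m = cylinder ((\<lambda>C. (C, m C)) ` \<C>)" for m
    by (auto simp: D_def cylinder_def)
  have D_sets: "D m \<in> sets config_space" for m
    unfolding D_cyl using \<C> by (intro cylinder_in_sets) auto
  have R_sets: "R i \<in> sets (borel \<Otimes>\<^sub>M config_space)" if "i \<in> I" for i
    using that \<C>(2) D_sets by (auto simp: I_def R_def)
  have "disjoint_family_on R I"
  proof (unfold disjoint_family_on_def, intro ballI impI)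
    fix i j assume ij: "i \<in> I" "j \<in> I" "i \<noteq> j"
    obtain C n where i: "i = (C, n)" by (cases i)
    obtain C' n' where j: "j = (C', n')" by (cases j)
    have "n = n'" if "\<gamma> \<in> D n" "\<gamma> \<in> D n'" for \<gamma>
    proof (rule ext)
      fix K show "n K = n' K"
      proof (cases "K \<in> \<C>")
        case True
        with that have "(of_nat (n K) :: ennreal) = of_nat (n' K)"
          unfolding D_def by simp
        then show ?thesis by simp
      next
        case False
        then show ?thesis
          using ij by (auto simp: i j I_def S_def PiE_def extensional_def)
      qed
    qed
    moreover have "C = C'" if "x \<in> C" "x \<in> C'" for x
      using ij that \<C>(3) by (auto simp: i j I_def disjoint_def)
    ultimately show "R i \<inter> R j = {}"
      using ij(3) by (auto simp: R_def i j)
  qed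
  have cyl: "cylinder Z = (\<Union>n\<in>S. D n)"
  proof (intro equalityI subsetI)
    have sum: "emeasure \<gamma> B = of_nat (\<Sum>C | C \<in> \<C> \<and> C \<subseteq> B. n C)"
      if \<gamma>: "\<gamma> \<in> D n" and B: "(B, k) \<in> Z" for \<gamma> B k n
    proof -
      have "\<gamma> \<in> configs" using \<gamma> by (simp add: D_def)
      have "B = \<Union>{C \<in> \<C>. C \<subseteq> B}"
        using B by (intro dec[rule_format]) force
      then have "emeasure \<gamma> B = emeasure \<gamma> (\<Union>C\<in>{C \<in> \<C>. C \<subseteq> B}. C)"
        by simp
      also have "\<dots> = (\<Sum>C\<in>{C \<in> \<C>. C \<subseteq> B}. emeasure \<gamma> C)"
        using \<C> by (intro sum_emeasure[symmetric])
          (auto simp: sets_config[OF \<open>\<gamma> \<in> configs\<close>] disjoint_family_on_def disjoint_def)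
      also have "\<dots> = of_nat (\<Sum>C | C \<in> \<C> \<and> C \<subseteq> B. n C)"
        using \<gamma> by (simp add: D_def)
      finally show ?thesis .
    qed
    {
      fix \<gamma> assume \<gamma>: "\<gamma> \<in> cylinder Z"
      then have \<gamma>': "\<gamma> \<in> configs" by (simp add: cylinder_def)
      have "\<forall>C\<in>\<C>. \<exists>k::nat. emeasure \<gamma> C = of_nat k"
        using config_nat[OF \<gamma>'] \<C>(2) by blast
      then obtain n where n: "\<And>C. C \<in> \<C> \<Longrightarrow> emeasure \<gamma> C = of_nat (n C :: nat)"
        by metis
      let ?n = "restrict n \<C>"
      have D: "\<gamma> \<in> D ?n"
        using \<gamma>' n by (simp add: D_def)
      have "(\<Sum>C | C \<in> \<C> \<and> C \<subseteq> B. ?n C) = k" if "(B, k) \<in> Z" for B k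
      proof -
        have "(of_nat (\<Sum>C | C \<in> \<C> \<and> C \<subseteq> B. ?n C) :: ennreal) = of_nat k"
          using sum[OF D that] \<gamma> that by (auto simp: cylinder_def)
        then show ?thesis by (simp only: of_nat_eq_iff)
      qed
      then have "?n \<in> S"
        by (auto simp: S_def)
      with D show "\<gamma> \<in> (\<Union>n\<in>S. D n)" by blast
    next
      fix \<gamma> assume "\<gamma> \<in> (\<Union>n\<in>S. D n)"
      then obtain n where n: "n \<in> S" "\<gamma> \<in> D n" by blast
      have "emeasure \<gamma> B = of_nat k" if "(B, k) \<in> Z" for B k
        using sum[OF n(2) that] n(1) that by (auto simp: S_def)
      then show "\<gamma> \<in> cylinder Z"
        using n(2) by (auto simp: cylinder_def D_def)
    }
  qed
  have A_eq: "A = \<Union>{C \<in> \<C>. C \<subseteq> A}"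
    by (rule dec[rule_format]) simp
  have "\<Union>{C \<in> \<C>. C \<subseteq> A} \<times> (\<Union>n\<in>S. D n) = (\<Union>i\<in>I. R i)"
    unfolding I_def R_def by auto
  then have UN: "A \<times> cylinder Z = (\<Union>i\<in>I. R i)"
    unfolding A_eq[symmetric] cyl[symmetric] .
  have "emeasure (reduced_campbell P) (A \<times> cylinder Z) = (\<integral>\<^sup>+i. emeasure (reduced_campbell P) (R i) \<partial>count_space I)"
    unfolding UN using R_sets \<open>countable I\<close> \<open>disjoint_family_on R I\<close>
    by (intro emeasure_UN_countable) (simp_all add: sets_reduced_campbell[OF sets_P])
  also have "\<dots> = (\<integral>\<^sup>+i. emeasure (\<rho> \<Otimes>\<^sub>M P) (R i) \<partial>count_space I)"
  proof (rule nn_integral_cong)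
    fix i assume "i \<in> space (count_space I)"
    then obtain C n where i: "i = (C, n)" "C \<in> \<C>" by (auto simp: I_def)
    then have "C \<in> sets \<rho>" using \<C>(2) by (auto simp: sets_\<rho>)
    then show "emeasure (reduced_campbell P) (R i) = emeasure (\<rho> \<Otimes>\<^sub>M P) (R i)"
      using campbell_poisson_atom[OF \<C> i(2), of n] D_sets[of n]
      by (simp add: R_def i D_def[symmetric] P.emeasure_pair_measure_Times sets_P)
  qed
  also have "\<dots> = emeasure (\<rho> \<Otimes>\<^sub>M P) (A \<times> cylinder Z)"
    unfolding UN using R_sets \<open>countable I\<close> \<open>disjoint_family_on R I\<close>
    by (intro emeasure_UN_countable[symmetric]) (simp_all add: sets_pair_measure_cong[OF sets_\<rho> sets_P])
  finally show ?thesis .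
qed

theorem mecke_equation: "reduced_campbell P = \<rho> \<Otimes>\<^sub>M P"
proof (rule measure_eqI_generator_eq)
  let ?E = "{A \<times> cylinder Z | A Z. A \<in> bounded_borel \<and> finite Z \<and> Z \<subseteq> bounded_borel \<times> UNIV}
    :: ('a \<times> 'a measure) set set"
  interpret P: prob_space P by (rule prob_space_P)
  show "Int_stable ?E"
  proof (rule Int_stableI)
    fix X X' assume "X \<in> ?E" "X' \<in> ?E"
    then obtain A A' Z Z' where X: "X = A \<times> cylinder Z" "X' = A' \<times> cylinder Z'"
      and *: "A \<in> bounded_borel" "finite Z" "Z \<subseteq> bounded_borel \<times> UNIV"
      "A' \<in> bounded_borel" "finite Z'" "Z' \<subseteq> bounded_borel \<times> UNIV"
      by blast
    have "cylinder Z \<inter> cylinder Z' = cylinder (Z \<union> Z')"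
      by (auto simp: cylinder_def)
    then have "X \<inter> X' = (A \<inter> A') \<times> cylinder (Z \<union> Z')"
      by (simp add: X Times_Int_Times)
    then show "X \<inter> X' \<in> ?E"
      using * by (intro CollectI exI[of _ "A \<inter> A'"] exI[of _ "Z \<union> Z'"]) auto
  qed
  show "?E \<subseteq> Pow (UNIV \<times> configs)"
    by (auto simp: cylinder_def)
  show "sets (reduced_campbell P) = sigma_sets (UNIV \<times> configs) ?E"
    by (simp add: sets_reduced_campbell[OF sets_P] sets_borel_config_space_rectangles)
  show "sets (\<rho> \<Otimes>\<^sub>M P) = sigma_sets (UNIV \<times> configs) ?E"
    by (simp add: sets_pair_measure_cong[OF sets_\<rho> sets_P] sets_borel_config_space_rectangles)
  show "emeasure (reduced_campbell P) X = emeasure (\<rho> \<Otimes>\<^sub>M P) X" if "X \<in> ?E" for X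
    using that campbell_poisson_rectangle by auto
  show "range (\<lambda>n::nat. ball 0 (real n) \<times> cylinder {}) \<subseteq> ?E"
    by auto
  show "(\<Union>n::nat. ball (0::'a) (real n) \<times> cylinder {}) = UNIV \<times> configs"
    unfolding cylinder_def using UN_ball_nat[where 'a='a] by auto
  \<comment> \<open>The finite expected number of points is not an assumption: the identity for
    rectangles itself computes it as the intensity of the ball.\<close>
  show "emeasure (reduced_campbell P) (ball 0 (real n) \<times> cylinder {}) \<noteq> \<infinity>" for n
  proof -
    have "emeasure (reduced_campbell P) (ball 0 (real n) \<times> cylinder {}) =
        emeasure \<rho> (ball 0 (real n)) * emeasure P (cylinder {})"
      using cylinder_in_sets[of "{} :: ('a set \<times> nat) set"]
      by (subst campbell_poisson_rectangle) (auto simp: P.emeasure_pair_measure_Times sets_P sets_\<rho>)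
    also have "\<dots> < \<infinity>"
      using \<rho>_finite[of "ball 0 (real n)"] P.emeasure_finite[of "cylinder {}"]
      by (simp add: ennreal_mult_eq_top_iff less_top[symmetric])
    finally show ?thesis by simp
  qed
qed

end

subsection \<open>Energies\<close>

lemma exp_neg_nonneg [simp]: "0 \<le> exp_neg e"
  by (simp add: exp_neg_def)

lemma exp_neg_PInf [simp]: "exp_neg \<infinity> = 0"
  by (simp add: exp_neg_def)

lemma measurable_exp_neg [measurable (raw)]:
  assumes [measurable]: "f \<in> borel_measurable M"
  shows "(\<lambda>x. exp_neg (f x)) \<in> borel_measurable M"
  unfolding exp_neg_def by measurable

text \<open>The value a = \<infinity> is harmless, but b must be finite: for b = \<infinity> the
  left side is 0 whatever a is. Heredity would force a = \<infinity> in that case; here it has to be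
  excluded.\<close>

lemma exp_neg_diff_mult:
  assumes "a \<noteq> - \<infinity>" "b \<noteq> - \<infinity>" "b < \<infinity>"
  shows "exp_neg (a - b) * exp_neg b = exp_neg a"
  using assms by (cases a; cases b) (auto simp: exp_neg_def mult_exp_exp)

section \<open>Energy decompositions and the local energy\<close>

context
  fixes H :: "'a::euclidean_space set \<Rightarrow> 'a measure \<Rightarrow> ereal"
  assumes H: "energy_family H"
begin

lemma measurable_energy: "\<Lambda> \<in> bounded_borel \<Longrightarrow> H \<Lambda> \<in> borel_measurable config_space"
  using H by (simp add: energy_family_def)

lemma energy_not_MInf: "\<Lambda> \<in> bounded_borel \<Longrightarrow> \<gamma> \<in> configs \<Longrightarrow> H \<Lambda> \<gamma> \<noteq> - \<infinity>"
  using H by (simp add: energy_family_def)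

lemma energy_decomp:
  assumes "\<Lambda> \<in> bounded_borel" "\<Lambda>' \<in> bounded_borel" "\<Lambda> \<subseteq> \<Lambda>'"
  shows "\<exists>\<phi>. (\<forall>\<gamma>\<in>configs. \<phi> \<gamma> \<noteq> - \<infinity>) \<and>
    (\<forall>\<gamma>\<in>configs. H \<Lambda>' \<gamma> = H \<Lambda> \<gamma> + \<phi> (restr (- \<Lambda>) \<gamma>))"
  using H assms unfolding energy_family_def by blast

text \<open>The outer term \<phi> is never -\<infinity>, so it cannot cancel an infinite energy of
  the smaller set.\<close>

lemma energy_finite_mono:
  assumes "\<Lambda> \<in> bounded_borel" "\<Lambda>' \<in> bounded_borel" "\<Lambda> \<subseteq> \<Lambda>'" "\<gamma> \<in> configs" "H \<Lambda>' \<gamma> < \<infinity>"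
  shows "H \<Lambda> \<gamma> < \<infinity>"
proof -
  obtain \<phi> where "\<forall>\<gamma>\<in>configs. \<phi> \<gamma> \<noteq> - \<infinity>"
    "\<forall>\<gamma>\<in>configs. H \<Lambda>' \<gamma> = H \<Lambda> \<gamma> + \<phi> (restr (- \<Lambda>) \<gamma>)"
    using energy_decomp[OF assms(1-3)] by blast
  note \<phi> = this[rule_format]
  have "restr (- \<Lambda>) \<gamma> \<in> configs"
    using assms by (intro restr_configs) (auto intro: borel_comp)
  then show ?thesis
    using \<phi>(1)[of "restr (- \<Lambda>) \<gamma>"] \<phi>(2)[OF assms(4)] assms(5) by auto
qed

text \<open>By monotonicity countably many conditions suffice, which makes the set measurable and
  lets almost sure statements be checked ball by ball.\<close>

lemma finite_energy_configs_balls: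
  "finite_energy_configs H = {\<gamma> \<in> configs. \<forall>n::nat. H (ball 0 (real n)) \<gamma> < \<infinity>}"
proof (intro equalityI subsetI)
  fix \<gamma> assume \<gamma>: "\<gamma> \<in> {\<gamma> \<in> configs. \<forall>n::nat. H (ball 0 (real n)) \<gamma> < \<infinity>}"
  have "H \<Lambda> \<gamma> < \<infinity>" if \<Lambda>: "\<Lambda> \<in> bounded_borel" for \<Lambda>
  proof -
    obtain n :: nat where "\<Lambda> \<subseteq> ball 0 (real n)"
      using bounded_borel_subset_ball[OF \<Lambda>] .
    from energy_finite_mono[OF \<Lambda> bounded_borel_ball this] \<gamma> show ?thesis
      by simp
  qed
  with \<gamma> show "\<gamma> \<in> finite_energy_configs H"
    by (simp add: finite_energy_configs_def)
qed (simp add: finite_energy_configs_def)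

lemma sets_finite_energy_configs: "finite_energy_configs H \<in> sets config_space"
proof -
  note measurable_energy[OF bounded_borel_ball, measurable]
  have "{\<gamma> \<in> space config_space. \<forall>n::nat. H (ball 0 (real n)) \<gamma> < \<infinity>} \<in> sets config_space"
    by measurable
  then show ?thesis
    by (simp add: finite_energy_configs_balls)
qed

text \<open>Inserting x inside \<Lambda> leaves the outer term \<phi> unchanged. It is finite
  because the larger set has finite energy at \<eta>, so it cancels in the difference.\<close>

lemma energy_increment_mono:
  assumes "\<Lambda> \<in> bounded_borel" "\<Lambda>' \<in> bounded_borel" "\<Lambda> \<subseteq> \<Lambda>'" "x \<in> \<Lambda>" "\<eta> \<in> configs" "H \<Lambda>' \<eta> < \<infinity>"
  shows "H \<Lambda>' (ins_pt x \<eta>) - H \<Lambda>' \<eta> = H \<Lambda> (ins_pt x \<eta>) - H \<Lambda> \<eta>"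
proof -
  obtain \<phi> where "\<forall>\<gamma>\<in>configs. \<phi> \<gamma> \<noteq> - \<infinity>"
    "\<forall>\<gamma>\<in>configs. H \<Lambda>' \<gamma> = H \<Lambda> \<gamma> + \<phi> (restr (- \<Lambda>) \<gamma>)"
    using energy_decomp[OF assms(1-3)] by blast
  note \<phi> = this[rule_format]
  have "restr (- \<Lambda>) \<eta> \<in> configs"
    using assms by (intro restr_configs) (auto intro: borel_comp)
  then have "\<phi> (restr (- \<Lambda>) \<eta>) \<noteq> - \<infinity>"
    by (rule \<phi>(1))
  moreover have "restr (- \<Lambda>) (ins_pt x \<eta>) = restr (- \<Lambda>) \<eta>"
    using assms by (intro restr_compl_ins_pt) auto
  moreover have "H \<Lambda> \<eta> \<noteq> - \<infinity>" "H \<Lambda> (ins_pt x \<eta>) \<noteq> - \<infinity>"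
    using energy_not_MInf[OF assms(1)] assms(5) by (simp_all add: ins_pt_configs)
  ultimately show ?thesis
    using assms(6) unfolding \<phi>(2)[OF assms(5)] \<phi>(2)[OF ins_pt_configs[OF assms(5), of x]]
    by (cases "H \<Lambda> \<eta>"; cases "H \<Lambda> (ins_pt x \<eta>)"; cases "\<phi> (restr (- \<Lambda>) \<eta>)") auto
qed

text \<open>The set chosen by \<open>SOME\<close> and the given \<Lambda> need not be nested; both
  increments are compared with that of their union.\<close>

lemma local_energy_eq:
  assumes \<eta>: "\<eta> \<in> finite_energy_configs H" and x: "x \<notin> points \<eta>" and \<Lambda>: "\<Lambda> \<in> bounded_borel" "x \<in> \<Lambda>"
  shows "local_energy H x \<eta> = H \<Lambda> (ins_pt x \<eta>) - H \<Lambda> \<eta>"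
proof -
  define \<Lambda>0 where "\<Lambda>0 = (SOME \<Lambda>. \<Lambda> \<in> bounded_borel \<and> x \<in> \<Lambda> \<and> H \<Lambda> \<eta> < \<infinity>)"
  have fin: "\<eta> \<in> configs" "\<And>\<Lambda>. \<Lambda> \<in> bounded_borel \<Longrightarrow> H \<Lambda> \<eta> < \<infinity>"
    using \<eta> by (simp_all add: finite_energy_configs_def)
  have "\<Lambda>0 \<in> bounded_borel \<and> x \<in> \<Lambda>0 \<and> H \<Lambda>0 \<eta> < \<infinity>"
    unfolding \<Lambda>0_def using \<Lambda> fin(2)[OF \<Lambda>(1)]
    by (intro someI[of "\<lambda>\<Lambda>. \<Lambda> \<in> bounded_borel \<and> x \<in> \<Lambda> \<and> H \<Lambda> \<eta> < \<infinity>" \<Lambda>]) simp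
  then have \<Lambda>0: "\<Lambda>0 \<in> bounded_borel" "x \<in> \<Lambda>0" by auto
  have Un: "\<Lambda> \<union> \<Lambda>0 \<in> bounded_borel"
    using \<Lambda> \<Lambda>0 by auto
  have "local_energy H x \<eta> = H \<Lambda>0 (ins_pt x \<eta>) - H \<Lambda>0 \<eta>"
    unfolding local_energy_def \<Lambda>0_def[symmetric] Let_def ins_pt_eq_add_return[OF fin(1) x] ..
  also have "\<dots> = H (\<Lambda> \<union> \<Lambda>0) (ins_pt x \<eta>) - H (\<Lambda> \<union> \<Lambda>0) \<eta>"
    using energy_increment_mono[OF \<Lambda>0(1) Un _ \<Lambda>0(2) fin(1) fin(2)[OF Un]] by simp
  also have "\<dots> = H \<Lambda> (ins_pt x \<eta>) - H \<Lambda> \<eta>"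
    using energy_increment_mono[OF \<Lambda>(1) Un _ \<Lambda>(2) fin(1) fin(2)[OF Un]] by simp
  finally show ?thesis .
qed

end

text \<open>Both measures become equal once cut down to \<Lambda>, since the outer part of the glued
  configuration has no mass there.\<close>

lemma nn_integral_glue:
  assumes "\<gamma>' \<in> configs" "\<gamma> \<in> configs" and \<Lambda>[measurable]: "\<Lambda> \<in> sets borel"
    and q[measurable]: "q \<in> borel_measurable borel"
  shows "(\<integral>\<^sup>+x. indicator \<Lambda> x * q x \<partial>glue \<Lambda> \<gamma>' \<gamma>) = (\<integral>\<^sup>+x. indicator \<Lambda> x * q x \<partial>\<gamma>')"
proof -
  note [measurable_cong] = sets_config[OF assms(1)]
  note [simp] = sets_config[OF assms(1)]
  have "density (glue \<Lambda> \<gamma>' \<gamma>) (indicator \<Lambda>) = density \<gamma>' (indicator \<Lambda>)"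
  proof (rule measure_eqI)
    fix A assume "A \<in> sets (density (glue \<Lambda> \<gamma>' \<gamma>) (indicator \<Lambda>))"
    then have A[measurable]: "A \<in> sets borel" by simp
    have dens: "emeasure (density M (indicator \<Lambda>)) A = emeasure M (A \<inter> \<Lambda>)" if M: "sets M = sets borel" for M
    proof -
      have "emeasure (density M (indicator \<Lambda>)) A = (\<integral>\<^sup>+x. indicator \<Lambda> x * indicator A x \<partial>M)"
        using M by (intro emeasure_density borel_measurable_indicator) auto
      also have "\<dots> = (\<integral>\<^sup>+x. indicator (A \<inter> \<Lambda>) x \<partial>M)"
        by (intro nn_integral_cong) (auto simp: indicator_def)
      finally show ?thesis
        using M by simp
    qed
    have [simp]: "A \<inter> \<Lambda> - \<Lambda> = {}" by auto
    show "emeasure (density (glue \<Lambda> \<gamma>' \<gamma>) (indicator \<Lambda>)) A = emeasure (density \<gamma>' (indicator \<Lambda>)) A"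
      using assms(1,2) by (simp add: dens emeasure_glue)
  qed simp
  then have "(\<integral>\<^sup>+x. q x \<partial>density (glue \<Lambda> \<gamma>' \<gamma>) (indicator \<Lambda>)) = (\<integral>\<^sup>+x. q x \<partial>density \<gamma>' (indicator \<Lambda>))"
    by simp
  moreover have "(\<integral>\<^sup>+x. indicator \<Lambda> x * q x \<partial>M) = (\<integral>\<^sup>+x. q x \<partial>density M (indicator \<Lambda>))"
    if M: "sets M = sets borel" for M
  proof -
    have "q \<in> borel_measurable M"
      using q by (simp add: measurable_cong_sets[OF M refl])
    with \<Lambda> M show ?thesis
      by (intro nn_integral_density[symmetric] borel_measurable_indicator) auto
  qed
  ultimately show ?thesis
    by simp
qed

lemma AE_notin_points:
  assumes "\<gamma> \<in> configs"
  shows "AE x in lborel. x \<notin> points \<gamma>"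
  using countable_imp_null_set_lborel[OF countable_points[OF assms]] by (rule AE_not_in)

subsection \<open>Gibbs measures\<close>

context
  fixes H :: "'a::euclidean_space set \<Rightarrow> 'a measure \<Rightarrow> ereal"
    and \<pi> :: "'a set \<Rightarrow> 'a measure measure"
    and \<mu> :: "'a measure measure"
  assumes H: "energy_family H"
    and \<pi>: "\<And>\<Lambda>. \<Lambda> \<in> bounded_borel \<Longrightarrow> poisson_on \<Lambda> (\<pi> \<Lambda>)"
    and \<mu>: "gibbs_measure \<pi> H \<mu>"
begin

lemma sets_gibbs [measurable_cong]: "sets \<mu> = sets config_space"
  using \<mu> by (simp add: gibbs_measure_def)

lemma prob_space_gibbs: "prob_space \<mu>"
  using \<mu> by (simp add: gibbs_measure_def)

lemma sets_\<pi>: "\<Lambda> \<in> bounded_borel \<Longrightarrow> sets (\<pi> \<Lambda>) = sets config_space"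
  using \<pi>[of \<Lambda>] by (simp add: poisson_on_def poisson_process_def)

lemma prob_space_\<pi>: "\<Lambda> \<in> bounded_borel \<Longrightarrow> prob_space (\<pi> \<Lambda>)"
  using \<pi>[of \<Lambda>] by (simp add: poisson_on_def poisson_process_def)

lemma measurable_snd_\<pi>: "\<Lambda> \<in> bounded_borel \<Longrightarrow> snd \<in> measurable (N \<Otimes>\<^sub>M \<pi> \<Lambda>) config_space"
  using measurable_snd[of N "\<pi> \<Lambda>"] by (simp add: measurable_cong_sets[OF refl sets_\<pi>])

lemma measurable_fst_gibbs: "fst \<in> measurable (\<mu> \<Otimes>\<^sub>M N) config_space"
  using measurable_fst[of \<mu> N] by (simp add: measurable_cong_sets[OF refl sets_gibbs])

section \<open>The Gibbs equation as an identity of measures\<close>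

lemma gibbs_kernel:
  assumes \<Lambda>: "\<Lambda> \<in> bounded_borel"
  defines "w \<equiv> \<lambda>(\<gamma>, \<gamma>'). ennreal (1 / enn2real (partition_function \<pi> H \<Lambda> (restr (- \<Lambda>) \<gamma>))) *
    ennreal (exp_neg (H \<Lambda> (glue \<Lambda> \<gamma>' \<gamma>)))"
  shows measurable_gibbs_weight: "w \<in> borel_measurable (\<mu> \<Otimes>\<^sub>M \<pi> \<Lambda>)"
    and gibbs_eq_distr: "\<mu> = distr (density (\<mu> \<Otimes>\<^sub>M \<pi> \<Lambda>) w) config_space (\<lambda>(\<gamma>, \<gamma>'). glue \<Lambda> \<gamma>' \<gamma>)"
proof -
  interpret \<mu>: prob_space \<mu> by (rule prob_space_gibbs)
  interpret P: prob_space "\<pi> \<Lambda>" by (rule prob_space_\<pi>[OF \<Lambda>])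
  note [measurable_cong] = sets_\<pi>[OF \<Lambda>]
  note [measurable] = measurable_snd_\<pi>[OF \<Lambda>] measurable_fst_gibbs
  note [measurable] = measurable_energy[OF H \<Lambda>] bounded_borelD(1)[OF \<Lambda>]
  let ?Z = "\<lambda>\<gamma>. partition_function \<pi> H \<Lambda> (restr (- \<Lambda>) \<gamma>)"
  have Z_eq: "?Z = (\<lambda>\<gamma>. \<integral>\<^sup>+\<gamma>'. ennreal (exp_neg (H \<Lambda> (glue \<Lambda> \<gamma>' \<gamma>))) \<partial>\<pi> \<Lambda>)"
    by (simp add: partition_function_def glue_def)
  have Z_meas [measurable]: "?Z \<in> borel_measurable config_space"
    unfolding Z_eq by measurable
  show w_meas [measurable]: "w \<in> borel_measurable (\<mu> \<Otimes>\<^sub>M \<pi> \<Lambda>)"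
    unfolding w_def by measurable
  have sp: "space \<mu> = configs" "space (\<pi> \<Lambda>) = configs"
    using space_law[OF sets_gibbs] space_law[OF sets_\<pi>[OF \<Lambda>]] by simp_all
  show "\<mu> = distr (density (\<mu> \<Otimes>\<^sub>M \<pi> \<Lambda>) w) config_space (\<lambda>(\<gamma>, \<gamma>'). glue \<Lambda> \<gamma>' \<gamma>)"
  proof (rule measure_eqI)
    fix S assume "S \<in> sets \<mu>"
    then have S [measurable]: "S \<in> sets config_space" by (simp add: sets_gibbs)
    define K where "K \<gamma> = (\<integral>\<^sup>+\<gamma>'. w (\<gamma>, \<gamma>') * indicator S (glue \<Lambda> \<gamma>' \<gamma>) \<partial>\<pi> \<Lambda>)" for \<gamma>
    have gl: "(\<lambda>z. glue \<Lambda> (snd z) (fst z)) \<in> measurable (\<mu> \<Otimes>\<^sub>M \<pi> \<Lambda>) config_space"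
      by measurable
    have wS: "(\<lambda>z. w z * indicator S (glue \<Lambda> (snd z) (fst z))) \<in> borel_measurable (\<mu> \<Otimes>\<^sub>M \<pi> \<Lambda>)"
      by (intro borel_measurable_times_ennreal w_meas measurable_compose[OF gl borel_measurable_indicator[OF S]])
    have K_meas [measurable]: "K \<in> borel_measurable \<mu>"
      unfolding K_def using P.borel_measurable_nn_integral_fst[OF wS] by simp
    have glue_sec: "(\<lambda>\<gamma>'. glue \<Lambda> \<gamma>' \<gamma>) \<in> measurable (\<pi> \<Lambda>) config_space" if "\<gamma> \<in> configs" for \<gamma>
      using measurable_Pair2[OF gl, of \<gamma>] that by (simp add: sp)
    \<comment> \<open>The kernel has total mass at most 1. Hence all integrals below are finite, and
      the passage from Bochner integrals to \<open>ennreal\<close> and back loses nothing.\<close>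
    have K_le_1: "K \<gamma> \<le> 1" if \<gamma>: "\<gamma> \<in> configs" for \<gamma>
    proof -
      note [measurable] = glue_sec[OF \<gamma>]
      have "K \<gamma> \<le> (\<integral>\<^sup>+\<gamma>'. w (\<gamma>, \<gamma>') \<partial>\<pi> \<Lambda>)"
        unfolding K_def by (intro nn_integral_mono) (simp add: indicator_def)
      also have "\<dots> = ennreal (1 / enn2real (?Z \<gamma>)) * ?Z \<gamma>"
        unfolding w_def by (simp add: nn_integral_cmult fun_cong[OF Z_eq, of \<gamma>])
      also have "\<dots> \<le> 1"
      \<comment> \<open>If Z is 0 or \<infinity>, the prefactor is 0 by the conventions for division
        and \<open>enn2real\<close>, and so is the product.\<close>
      proof (cases "?Z \<gamma>")
        case (real r)
        then show ?thesis
          by (cases "r = 0") (auto simp: ennreal_mult'[symmetric])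
      qed simp
      finally show ?thesis .
    qed
    let ?f = "indicator S :: 'a measure \<Rightarrow> real"
    have J: "(\<integral>\<gamma>'. ?f (glue \<Lambda> \<gamma>' \<gamma>) * (1 / enn2real (?Z \<gamma>)) * exp_neg (H \<Lambda> (glue \<Lambda> \<gamma>' \<gamma>)) \<partial>\<pi> \<Lambda>) =
        enn2real (K \<gamma>)" if \<gamma>: "\<gamma> \<in> configs" for \<gamma>
    proof -
      note [measurable] = glue_sec[OF \<gamma>]
      have "(\<integral>\<gamma>'. ?f (glue \<Lambda> \<gamma>' \<gamma>) * (1 / enn2real (?Z \<gamma>)) * exp_neg (H \<Lambda> (glue \<Lambda> \<gamma>' \<gamma>)) \<partial>\<pi> \<Lambda>) =
        enn2real (\<integral>\<^sup>+\<gamma>'. ennreal (?f (glue \<Lambda> \<gamma>' \<gamma>) * (1 / enn2real (?Z \<gamma>)) * exp_neg (H \<Lambda> (glue \<Lambda> \<gamma>' \<gamma>))) \<partial>\<pi> \<Lambda>)"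
        by (intro integral_eq_nn_integral) auto
      also have "\<dots> = enn2real (K \<gamma>)"
        unfolding K_def w_def
        by (intro arg_cong[where f=enn2real] nn_integral_cong)
           (auto simp: ennreal_mult'' simp del: times_divide_eq_left split: split_indicator)
      finally show ?thesis .
    qed
    have "(\<integral>\<gamma>. ?f \<gamma> \<partial>\<mu>) = (\<integral>\<gamma>. (\<integral>\<gamma>'. ?f (glue \<Lambda> \<gamma>' \<gamma>) * (1 / enn2real (?Z \<gamma>)) * exp_neg (H \<Lambda> (glue \<Lambda> \<gamma>' \<gamma>)) \<partial>\<pi> \<Lambda>) \<partial>\<mu>)"
    proof -
      have "?f \<in> borel_measurable config_space"
        by measurable
      moreover have "bounded (?f ` configs)"
        by (rule boundedI[of _ 1]) (auto simp: indicator_def)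
      ultimately show ?thesis
        using \<mu> \<Lambda> unfolding gibbs_measure_def glue_def by blast
    qed
    also have "\<dots> = (\<integral>\<gamma>. enn2real (K \<gamma>) \<partial>\<mu>)"
      using sp by (intro Bochner_Integration.integral_cong[OF refl] J) simp
    also have "\<dots> = enn2real (\<integral>\<^sup>+\<gamma>. ennreal (enn2real (K \<gamma>)) \<partial>\<mu>)"
      by (intro integral_eq_nn_integral) auto
    also have "(\<integral>\<^sup>+\<gamma>. ennreal (enn2real (K \<gamma>)) \<partial>\<mu>) = (\<integral>\<^sup>+\<gamma>. K \<gamma> \<partial>\<mu>)"
      using le_less_trans[OF K_le_1 ennreal_one_less_top]
      by (intro nn_integral_cong ennreal_enn2real) (simp add: sp)
    finally have meas: "measure \<mu> S = enn2real (\<integral>\<^sup>+\<gamma>. K \<gamma> \<partial>\<mu>)"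
      by (simp add: sp S[THEN sets.sets_into_space, simplified] Int_absorb2)
    have "(\<integral>\<^sup>+\<gamma>. K \<gamma> \<partial>\<mu>) \<le> (\<integral>\<^sup>+\<gamma>. 1 \<partial>\<mu>)"
      using K_le_1 by (intro nn_integral_mono) (simp add: sp)
    also have "\<dots> < \<top>"
      by (simp add: \<mu>.emeasure_space_1)
    finally have "emeasure \<mu> S = (\<integral>\<^sup>+\<gamma>. K \<gamma> \<partial>\<mu>)"
      by (simp add: \<mu>.emeasure_eq_measure meas)
    also have "\<dots> = (\<integral>\<^sup>+z. w z * indicator S (case z of (\<gamma>, \<gamma>') \<Rightarrow> glue \<Lambda> \<gamma>' \<gamma>) \<partial>(\<mu> \<Otimes>\<^sub>M \<pi> \<Lambda>))"
      unfolding K_def using P.nn_integral_fst[OF wS] by (simp add: case_prod_beta')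
    also have "\<dots> = (\<integral>\<^sup>+z. indicator S (case z of (\<gamma>, \<gamma>') \<Rightarrow> glue \<Lambda> \<gamma>' \<gamma>) \<partial>density (\<mu> \<Otimes>\<^sub>M \<pi> \<Lambda>) w)"
      using gl by (intro nn_integral_density[symmetric] w_meas measurable_compose[OF _ borel_measurable_indicator[OF S]])
        (simp add: case_prod_beta')
    also have "\<dots> = (\<integral>\<^sup>+z. indicator S z \<partial>distr (density (\<mu> \<Otimes>\<^sub>M \<pi> \<Lambda>) w) config_space (\<lambda>(\<gamma>, \<gamma>'). glue \<Lambda> \<gamma>' \<gamma>))"
      using gl S by (intro nn_integral_distr[symmetric]) (simp_all add: case_prod_beta')
    also have "\<dots> = emeasure (distr (density (\<mu> \<Otimes>\<^sub>M \<pi> \<Lambda>) w) config_space (\<lambda>(\<gamma>, \<gamma>'). glue \<Lambda> \<gamma>' \<gamma>)) S"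
      by simp
    finally show "emeasure \<mu> S = emeasure (distr (density (\<mu> \<Otimes>\<^sub>M \<pi> \<Lambda>) w) config_space (\<lambda>(\<gamma>, \<gamma>'). glue \<Lambda> \<gamma>' \<gamma>)) S" .
  qed (simp add: sets_gibbs)
qed

text \<open>The measure identity gives the Gibbs equation for unbounded F as well. This matters
  because Campbell sums grow with the number of points in \<Lambda>.\<close>

lemma nn_integral_gibbs:
  assumes \<Lambda>: "\<Lambda> \<in> bounded_borel" and F [measurable]: "F \<in> borel_measurable config_space"
  shows "(\<integral>\<^sup>+\<gamma>. F \<gamma> \<partial>\<mu>) =
    (\<integral>\<^sup>+\<gamma>. ennreal (1 / enn2real (partition_function \<pi> H \<Lambda> (restr (- \<Lambda>) \<gamma>))) *
      (\<integral>\<^sup>+\<gamma>'. F (glue \<Lambda> \<gamma>' \<gamma>) * ennreal (exp_neg (H \<Lambda> (glue \<Lambda> \<gamma>' \<gamma>))) \<partial>\<pi> \<Lambda>) \<partial>\<mu>)"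
proof -
  interpret P: prob_space "\<pi> \<Lambda>" by (rule prob_space_\<pi>[OF \<Lambda>])
  note [measurable_cong] = sets_\<pi>[OF \<Lambda>]
  note [measurable] = measurable_snd_\<pi>[OF \<Lambda>] measurable_fst_gibbs
  note [measurable] = measurable_energy[OF H \<Lambda>] bounded_borelD(1)[OF \<Lambda>]
  let ?c = "\<lambda>\<gamma>. ennreal (1 / enn2real (partition_function \<pi> H \<Lambda> (restr (- \<Lambda>) \<gamma>)))"
  let ?w = "\<lambda>(\<gamma>, \<gamma>'). ?c \<gamma> * ennreal (exp_neg (H \<Lambda> (glue \<Lambda> \<gamma>' \<gamma>)))"
  note w = measurable_gibbs_weight[OF \<Lambda>]
  have gl: "(\<lambda>(\<gamma>, \<gamma>'). glue \<Lambda> \<gamma>' \<gamma>) \<in> measurable (\<mu> \<Otimes>\<^sub>M \<pi> \<Lambda>) config_space"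
    by measurable
  have "(\<integral>\<^sup>+\<gamma>. F \<gamma> \<partial>\<mu>) =
      (\<integral>\<^sup>+\<gamma>. F \<gamma> \<partial>distr (density (\<mu> \<Otimes>\<^sub>M \<pi> \<Lambda>) ?w) config_space (\<lambda>(\<gamma>, \<gamma>'). glue \<Lambda> \<gamma>' \<gamma>))"
    by (rule arg_cong[OF gibbs_eq_distr[OF \<Lambda>]])
  also have "\<dots> = (\<integral>\<^sup>+z. F (case z of (\<gamma>, \<gamma>') \<Rightarrow> glue \<Lambda> \<gamma>' \<gamma>) \<partial>density (\<mu> \<Otimes>\<^sub>M \<pi> \<Lambda>) ?w)"
    using gl F by (intro nn_integral_distr) simp_all
  also have "\<dots> = (\<integral>\<^sup>+z. ?w z * F (case z of (\<gamma>, \<gamma>') \<Rightarrow> glue \<Lambda> \<gamma>' \<gamma>) \<partial>(\<mu> \<Otimes>\<^sub>M \<pi> \<Lambda>))"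
    by (intro nn_integral_density w measurable_compose[OF gl F])
  also have "\<dots> = (\<integral>\<^sup>+\<gamma>. \<integral>\<^sup>+\<gamma>'. ?w (\<gamma>, \<gamma>') * F (glue \<Lambda> \<gamma>' \<gamma>) \<partial>\<pi> \<Lambda> \<partial>\<mu>)"
    using P.nn_integral_fst[OF borel_measurable_times_ennreal[OF w measurable_compose[OF gl F]]]
    by (simp add: case_prod_beta')
  also have "\<dots> = (\<integral>\<^sup>+\<gamma>. ?c \<gamma> *
      (\<integral>\<^sup>+\<gamma>'. F (glue \<Lambda> \<gamma>' \<gamma>) * ennreal (exp_neg (H \<Lambda> (glue \<Lambda> \<gamma>' \<gamma>))) \<partial>\<pi> \<Lambda>) \<partial>\<mu>)"
  proof (rule nn_integral_cong)
    fix \<gamma> assume "\<gamma> \<in> space \<mu>"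
    then have [measurable]: "(\<lambda>\<gamma>'. glue \<Lambda> \<gamma>' \<gamma>) \<in> measurable (\<pi> \<Lambda>) config_space"
      using measurable_Pair2[OF gl, of \<gamma>] by simp
    have "(\<integral>\<^sup>+\<gamma>'. ?w (\<gamma>, \<gamma>') * F (glue \<Lambda> \<gamma>' \<gamma>) \<partial>\<pi> \<Lambda>) =
        (\<integral>\<^sup>+\<gamma>'. ?c \<gamma> * (F (glue \<Lambda> \<gamma>' \<gamma>) * ennreal (exp_neg (H \<Lambda> (glue \<Lambda> \<gamma>' \<gamma>)))) \<partial>\<pi> \<Lambda>)"
      by (intro nn_integral_cong) (simp add: ac_simps)
    also have "\<dots> = ?c \<gamma> * (\<integral>\<^sup>+\<gamma>'. F (glue \<Lambda> \<gamma>' \<gamma>) * ennreal (exp_neg (H \<Lambda> (glue \<Lambda> \<gamma>' \<gamma>))) \<partial>\<pi> \<Lambda>)"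
      by (intro nn_integral_cmult) measurable
    finally show "(\<integral>\<^sup>+\<gamma>'. ?w (\<gamma>, \<gamma>') * F (glue \<Lambda> \<gamma>' \<gamma>) \<partial>\<pi> \<Lambda>) =
        ?c \<gamma> * (\<integral>\<^sup>+\<gamma>'. F (glue \<Lambda> \<gamma>' \<gamma>) * ennreal (exp_neg (H \<Lambda> (glue \<Lambda> \<gamma>' \<gamma>))) \<partial>\<pi> \<Lambda>)" .
  qed
  finally show ?thesis .
qed

text \<open>A configuration of infinite energy in a ball has weight 0 in the kernel of that very
  ball, so resampling never produces it.\<close>

lemma AE_finite_energy: "AE \<gamma> in \<mu>. \<gamma> \<in> finite_energy_configs H"
proof -
  have "AE \<gamma> in \<mu>. H (ball 0 (real n)) \<gamma> < \<infinity>" for n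
  proof -
    let ?B = "ball (0::'a) (real n)"
    note [measurable] = measurable_energy[OF H bounded_borel_ball]
    define S where "S = {\<gamma> \<in> space config_space. H ?B \<gamma> = \<infinity>}"
    have inf [measurable]: "S \<in> sets config_space"
      unfolding S_def by measurable
    have 0: "indicator S \<gamma> * ennreal (exp_neg (H ?B \<gamma>)) = 0" for \<gamma>
      by (auto simp: S_def indicator_def)
    have "emeasure \<mu> S = (\<integral>\<^sup>+\<gamma>. indicator S \<gamma> \<partial>\<mu>)"
      using inf by (simp add: sets_gibbs)
    also have "\<dots> = 0"
      by (subst nn_integral_gibbs[OF bounded_borel_ball[of 0 "real n"]]) (simp_all add: 0)
    finally show ?thesis
      using inf by (intro AE_I[where N=S])
        (auto simp: S_def sets_gibbs space_law[OF sets_gibbs])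
  qed
  then have "AE \<gamma> in \<mu>. \<forall>n::nat. H (ball 0 (real n)) \<gamma> < \<infinity>"
    by (simp add: AE_all_countable)
  with AE_space show ?thesis
    by eventually_elim (simp add: finite_energy_configs_balls[OF H] space_law[OF sets_gibbs])
qed

section \<open>From the Mecke equation to Gibbs measures\<close>

lemma reduced_campbell_\<pi>:
  assumes \<Lambda>: "\<Lambda> \<in> bounded_borel"
  shows "reduced_campbell (\<pi> \<Lambda>) = density lborel (indicator \<Lambda>) \<Otimes>\<^sub>M \<pi> \<Lambda>"
proof (rule mecke_equation)
  have [measurable]: "\<Lambda> \<in> sets borel"
    using \<Lambda> by auto
  show "emeasure (density lborel (indicator \<Lambda>)) A < \<infinity>" if "A \<in> bounded_borel" for A
  proof -
    have [measurable]: "A \<in> sets borel"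
      using that by auto
    have "emeasure (density lborel (indicator \<Lambda>)) A = (\<integral>\<^sup>+x. indicator \<Lambda> x * indicator A x \<partial>lborel)"
      by (intro emeasure_density) measurable
    also have "\<dots> \<le> (\<integral>\<^sup>+x. indicator A x \<partial>lborel)"
      by (intro nn_integral_mono) (simp add: indicator_def)
    also have "\<dots> = emeasure lborel A"
      by simp
    also have "\<dots> < \<infinity>"
      using emeasure_bounded_finite[OF bounded_borelD(2)[OF that]] .
    finally show ?thesis .
  qed
  show "poisson_process (density lborel (indicator \<Lambda>)) (\<pi> \<Lambda>)"
    using \<pi>[OF \<Lambda>] by (simp add: poisson_on_def)
qed simp

text \<open>Inside \<open>\<Lambda>\<close> the Gibbs kernel has a density with respect to the Poisson process, so that the
  Mecke equation applies; the densities with and without the point \<open>x\<close> differ by the factor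
  \<open>exp (- h(x, \<gamma>))\<close>.\<close>
lemma gibbs_campbell_local:
  assumes \<Lambda>: "\<Lambda> \<in> bounded_borel" and F: "F \<in> borel_measurable (borel \<Otimes>\<^sub>M config_space)"
    and F0: "\<And>x \<gamma>. x \<notin> \<Lambda> \<or> H \<Lambda> \<gamma> = \<infinity> \<Longrightarrow> F (x, \<gamma>) = 0"
  shows "(\<integral>\<^sup>+z. F z \<partial>reduced_campbell \<mu>) =
    (\<integral>\<^sup>+\<gamma>. \<integral>\<^sup>+x. F (x, \<gamma>) * ennreal (exp_neg (H \<Lambda> (ins_pt x \<gamma>) - H \<Lambda> \<gamma>)) \<partial>lborel \<partial>\<mu>)"
proof -
  note sets_\<pi> = sets_\<pi>[OF \<Lambda>]
  interpret P: prob_space "\<pi> \<Lambda>" by (rule prob_space_\<pi>[OF \<Lambda>])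
  note [measurable] = measurable_energy[OF H \<Lambda>] bounded_borelD(1)[OF \<Lambda>] F
  let ?e = "\<lambda>\<xi>. ennreal (exp_neg (H \<Lambda> \<xi>))"
  let ?c = "\<lambda>\<gamma>. ennreal (1 / enn2real (partition_function \<pi> H \<Lambda> (restr (- \<Lambda>) \<gamma>)))"
  \<comment> \<open>\<open>G\<close> sums over removed points and \<open>R\<close> integrates over
    inserted ones, so the claim is that they have the same \<mu>-integral. For this it suffices
    that, for each fixed outer configuration, they have the same weighted Poisson integral.\<close>
  define G where "G \<gamma> = (\<integral>\<^sup>+x. F (x, del_pt x \<gamma>) \<partial>\<gamma>)" for \<gamma>
  define R where "R \<gamma> = (\<integral>\<^sup>+x. F (x, \<gamma>) * ennreal (exp_neg (H \<Lambda> (ins_pt x \<gamma>) - H \<Lambda> \<gamma>)) \<partial>lborel)" for \<gamma>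
  have G_meas: "G \<in> borel_measurable config_space"
    using measurable_campbell_inner[OF refl F] by (simp add: G_def[abs_def])
  have "(\<lambda>z. F (snd z, fst z) * ennreal (exp_neg (H \<Lambda> (ins_pt (snd z) (fst z)) - H \<Lambda> (fst z))))
      \<in> borel_measurable (config_space \<Otimes>\<^sub>M borel)"
    by measurable
  then have R_integrand: "(\<lambda>z. F (snd z, fst z) * ennreal (exp_neg (H \<Lambda> (ins_pt (snd z) (fst z)) - H \<Lambda> (fst z))))
      \<in> borel_measurable (config_space \<Otimes>\<^sub>M lborel)"
    by (simp add: measurable_cong_sets[OF sets_pair_measure_cong[OF refl sets_lborel] refl])
  then have R_meas: "R \<in> borel_measurable config_space"
    unfolding R_def using lborel.borel_measurable_nn_integral_fst[OF R_integrand] by simp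
  have inner: "(\<integral>\<^sup>+\<gamma>'. G (glue \<Lambda> \<gamma>' \<gamma>) * ?e (glue \<Lambda> \<gamma>' \<gamma>) \<partial>\<pi> \<Lambda>) =
      (\<integral>\<^sup>+\<gamma>'. R (glue \<Lambda> \<gamma>' \<gamma>) * ?e (glue \<Lambda> \<gamma>' \<gamma>) \<partial>\<pi> \<Lambda>)" if \<gamma>: "\<gamma> \<in> configs" for \<gamma>
  proof -
    \<comment> \<open>\<open>g\<close> is a function of x and the inner configuration without x. Its
      weight puts x back, so along the Campbell sum it is the weight of the original glued
      configuration.\<close>
    define g where "g z = F (fst z, glue \<Lambda> (snd z) \<gamma>) * ?e (ins_pt (fst z) (glue \<Lambda> (snd z) \<gamma>))" for z
    have [measurable]: "(\<lambda>_. \<gamma>) \<in> measurable N config_space" for N :: "('a \<times> 'a measure) measure"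
      using \<gamma> by simp
    have g_meas: "g \<in> borel_measurable (borel \<Otimes>\<^sub>M config_space)"
      unfolding g_def by measurable
    have "(\<integral>\<^sup>+\<gamma>'. G (glue \<Lambda> \<gamma>' \<gamma>) * ?e (glue \<Lambda> \<gamma>' \<gamma>) \<partial>\<pi> \<Lambda>) =
        (\<integral>\<^sup>+\<gamma>'. \<integral>\<^sup>+x. g (x, del_pt x \<gamma>') \<partial>\<gamma>' \<partial>\<pi> \<Lambda>)"
    proof (rule nn_integral_cong)
      fix \<gamma>' assume "\<gamma>' \<in> space (\<pi> \<Lambda>)"
      then have \<gamma>': "\<gamma>' \<in> configs" by (simp add: space_law[OF sets_\<pi>])
      define \<xi> where "\<xi> = glue \<Lambda> \<gamma>' \<gamma>"
      have \<xi>: "\<xi> \<in> configs"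
        unfolding \<xi>_def using \<gamma> \<gamma>' \<Lambda> by (intro glue_configs) auto
      have q: "(\<lambda>x. F (x, del_pt x \<xi>)) \<in> borel_measurable borel"
        using measurable_campbell_integrand[OF F \<xi>] by (simp add: measurable_cong_sets[OF sets_config[OF \<xi>] refl])
      \<comment> \<open>Since \<open>F\<close> lives on x \<in> \<Lambda>, the points of \<gamma>
        outside \<Lambda> and those of \<gamma>' outside \<Lambda> both drop out, and the two sums
        can be exchanged.\<close>
      have ind: "F (x, \<zeta>) = indicator \<Lambda> x * F (x, \<zeta>)" for x \<zeta>
        using F0 by (auto simp: indicator_def)
      have "G \<xi> = (\<integral>\<^sup>+x. indicator \<Lambda> x * F (x, del_pt x \<xi>) \<partial>\<xi>)"
        unfolding G_def by (subst ind) simp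
      also have "\<dots> = (\<integral>\<^sup>+x. indicator \<Lambda> x * F (x, del_pt x \<xi>) \<partial>\<gamma>')"
        using nn_integral_glue[OF \<gamma>' \<gamma> _ q] \<Lambda> by (auto simp: \<xi>_def)
      also have "\<dots> = (\<integral>\<^sup>+x. F (x, del_pt x \<xi>) \<partial>\<gamma>')"
        by (subst (2) ind) simp
      finally have "G \<xi> * ?e \<xi> = (\<integral>\<^sup>+x. F (x, del_pt x \<xi>) * ?e \<xi> \<partial>\<gamma>')"
        using q by (simp add: nn_integral_multc measurable_cong_sets[OF sets_config[OF \<gamma>'] refl])
      also have "\<dots> = (\<integral>\<^sup>+x. g (x, del_pt x \<gamma>') \<partial>\<gamma>')"
      proof (rule nn_integral_cong_AE)
        show "AE x in \<gamma>'. F (x, del_pt x \<xi>) * ?e \<xi> = g (x, del_pt x \<gamma>')"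
          using AE_in_points[OF \<gamma>']
        proof eventually_elim
          case (elim x)
          show ?case
          proof (cases "x \<in> \<Lambda>")
            case True
            have "del_pt x \<xi> = glue \<Lambda> (del_pt x \<gamma>') \<gamma>"
              unfolding \<xi>_def using \<gamma> \<gamma>' \<Lambda> True by (intro del_pt_glue) auto
            moreover have "x \<in> points \<xi>"
              using points_glue[OF \<gamma>' \<gamma> bounded_borelD(1)[OF \<Lambda>]] elim True by (auto simp: \<xi>_def)
            then have "ins_pt x (del_pt x \<xi>) = \<xi>"
              by (rule ins_pt_del_pt[OF \<xi>])
            ultimately show ?thesis
              by (simp add: g_def)
          next
            case False
            then show ?thesis
              by (simp add: g_def F0)
          qed
        qed
      qed
      finally show "G (glue \<Lambda> \<gamma>' \<gamma>) * ?e (glue \<Lambda> \<gamma>' \<gamma>) = (\<integral>\<^sup>+x. g (x, del_pt x \<gamma>') \<partial>\<gamma>')"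
        by (simp add: \<xi>_def)
    qed
    also have "\<dots> = (\<integral>\<^sup>+z. g z \<partial>(density lborel (indicator \<Lambda>) \<Otimes>\<^sub>M \<pi> \<Lambda>))"
      unfolding reduced_campbell_\<pi>[OF \<Lambda>, symmetric]
      by (rule nn_integral_reduced_campbell[OF sets_\<pi> g_meas, symmetric])
    \<comment> \<open>The Poisson configuration becomes the outer variable again, as the Gibbs
      kernel requires.\<close>
    also have "\<dots> = (\<integral>\<^sup>+\<gamma>'. \<integral>\<^sup>+x. g (x, \<gamma>') \<partial>density lborel (indicator \<Lambda>) \<partial>\<pi> \<Lambda>)"
    proof -
      have "finite_measure (density lborel (indicator \<Lambda>) :: 'a measure)"
      proof (rule finite_measureI)
        have "emeasure (density lborel (indicator \<Lambda>)) (space (density lborel (indicator \<Lambda>))) = emeasure lborel \<Lambda>"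
          using bounded_borelD(1)[OF \<Lambda>] by (simp add: emeasure_density)
        then show "emeasure (density lborel (indicator \<Lambda>)) (space (density lborel (indicator \<Lambda>))) \<noteq> \<infinity>"
          using emeasure_bounded_finite[OF bounded_borelD(2)[OF \<Lambda>]] by simp
      qed
      then interpret L: finite_measure "density lborel (indicator \<Lambda>) :: 'a measure" .
      interpret pair_sigma_finite "density lborel (indicator \<Lambda>) :: 'a measure" "\<pi> \<Lambda>" ..
      have "sets (density lborel (indicator \<Lambda>) :: 'a measure) = sets borel"
        by simp
      then have g': "g \<in> borel_measurable (density lborel (indicator \<Lambda>) \<Otimes>\<^sub>M \<pi> \<Lambda>)"
        using g_meas measurable_cong_sets[OF sets_pair_measure_cong[OF _ sets_\<pi>] refl] by blast
      show ?thesis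
        using nn_integral_snd[of g] g' by simp
    qed
    also have "\<dots> = (\<integral>\<^sup>+\<gamma>'. R (glue \<Lambda> \<gamma>' \<gamma>) * ?e (glue \<Lambda> \<gamma>' \<gamma>) \<partial>\<pi> \<Lambda>)"
    proof (rule nn_integral_cong)
      fix \<gamma>' assume "\<gamma>' \<in> space (\<pi> \<Lambda>)"
      then have \<gamma>': "\<gamma>' \<in> configs" by (simp add: space_law[OF sets_\<pi>])
      define \<xi> where "\<xi> = glue \<Lambda> \<gamma>' \<gamma>"
      have \<xi>: "\<xi> \<in> configs"
        unfolding \<xi>_def using \<gamma> \<gamma>' \<Lambda> by (intro glue_configs) auto
      have gm: "(\<lambda>x. g (x, \<gamma>')) \<in> borel_measurable borel"
        using measurable_Pair1[OF g_meas, of \<gamma>'] \<gamma>' by simp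
      \<comment> \<open>The only place where heredity would matter: if \<xi> has infinite energy,
        the left weight may be positive, but \<open>F\<close> vanishes there by assumption.\<close>
      have E: "F (x, \<xi>) * ?e (ins_pt x \<xi>) = F (x, \<xi>) * ennreal (exp_neg (H \<Lambda> (ins_pt x \<xi>) - H \<Lambda> \<xi>)) * ?e \<xi>" for x
      proof (cases "H \<Lambda> \<xi> = \<infinity>")
        case True
        then show ?thesis by (simp add: F0)
      next
        case False
        then have "exp_neg (H \<Lambda> (ins_pt x \<xi>) - H \<Lambda> \<xi>) * exp_neg (H \<Lambda> \<xi>) = exp_neg (H \<Lambda> (ins_pt x \<xi>))"
          using energy_not_MInf[OF H \<Lambda>] \<xi> by (intro exp_neg_diff_mult) (simp_all add: ins_pt_configs)
        then show ?thesis
          by (simp add: ennreal_mult''[symmetric] mult.assoc)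
      qed
      have "(\<integral>\<^sup>+x. g (x, \<gamma>') \<partial>density lborel (indicator \<Lambda>)) = (\<integral>\<^sup>+x. indicator \<Lambda> x * g (x, \<gamma>') \<partial>lborel)"
        using gm bounded_borelD(1)[OF \<Lambda>] by (intro nn_integral_density) simp_all
      also have "\<dots> = (\<integral>\<^sup>+x. F (x, \<xi>) * ?e (ins_pt x \<xi>) \<partial>lborel)"
        using F0 by (intro nn_integral_cong) (auto simp: g_def \<xi>_def indicator_def)
      also have "\<dots> = (\<integral>\<^sup>+x. F (x, \<xi>) * ennreal (exp_neg (H \<Lambda> (ins_pt x \<xi>) - H \<Lambda> \<xi>)) * ?e \<xi> \<partial>lborel)"
        unfolding E ..
      also have "\<dots> = R \<xi> * ?e \<xi>"
        unfolding R_def using measurable_Pair2[OF R_integrand, of \<xi>] \<xi> by (intro nn_integral_multc) simp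
      finally show "(\<integral>\<^sup>+x. g (x, \<gamma>') \<partial>density lborel (indicator \<Lambda>)) = R (glue \<Lambda> \<gamma>' \<gamma>) * ?e (glue \<Lambda> \<gamma>' \<gamma>)"
        by (simp add: \<xi>_def)
    qed
    finally show ?thesis .
  qed
  have "(\<integral>\<^sup>+z. F z \<partial>reduced_campbell \<mu>) = (\<integral>\<^sup>+\<gamma>. G \<gamma> \<partial>\<mu>)"
    unfolding G_def using F by (intro nn_integral_reduced_campbell sets_gibbs)
  also have "\<dots> = (\<integral>\<^sup>+\<gamma>. ?c \<gamma> * (\<integral>\<^sup>+\<gamma>'. G (glue \<Lambda> \<gamma>' \<gamma>) * ?e (glue \<Lambda> \<gamma>' \<gamma>) \<partial>\<pi> \<Lambda>) \<partial>\<mu>)"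
    by (rule nn_integral_gibbs[OF \<Lambda> G_meas])
  also have "\<dots> = (\<integral>\<^sup>+\<gamma>. ?c \<gamma> * (\<integral>\<^sup>+\<gamma>'. R (glue \<Lambda> \<gamma>' \<gamma>) * ?e (glue \<Lambda> \<gamma>' \<gamma>) \<partial>\<pi> \<Lambda>) \<partial>\<mu>)"
    by (intro nn_integral_cong) (simp add: inner space_law[OF sets_gibbs])
  also have "\<dots> = (\<integral>\<^sup>+\<gamma>. R \<gamma> \<partial>\<mu>)"
    by (rule nn_integral_gibbs[OF \<Lambda> R_meas, symmetric])
  finally show ?thesis
    unfolding R_def .
qed

theorem gibbs_campbell:
  assumes f: "f \<in> borel_measurable (borel \<Otimes>\<^sub>M config_space)"
  shows "(\<integral>\<^sup>+(x, \<gamma>). indicator (finite_energy_configs H) \<gamma> * f (x, \<gamma>) \<partial>reduced_campbell \<mu>) =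
    (\<integral>\<^sup>+x. \<integral>\<^sup>+\<gamma>. f (x, \<gamma>) * ennreal (exp_neg (local_energy H x \<gamma>)) \<partial>\<mu> \<partial>lborel)"
proof -
  let ?FE = "finite_energy_configs H"
  interpret \<mu>: prob_space \<mu> by (rule prob_space_gibbs)
  interpret L: pair_sigma_finite "lborel :: 'a measure" \<mu> ..
  note [measurable] = sets_finite_energy_configs[OF H] measurable_energy[OF H bounded_borel_ball] f
  \<comment> \<open>The successor of the integer part puts x inside the open ball. Natural values
    keep the selection of the ball countable, hence measurable.\<close>
  define N where "N x = Suc (nat \<lfloor>norm x\<rfloor>)" for x :: 'a
  have N_ball: "x \<in> ball 0 (real (N x))" for x
    unfolding N_def by (simp add: dist_norm) linarith
  have N_meas [measurable]: "(\<lambda>z. N (fst z)) \<in> measurable (borel \<Otimes>\<^sub>M config_space) (count_space UNIV)"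
    unfolding N_def by measurable
  \<comment> \<open>A measurable stand-in for exp(-h): it equals it at finite energy configurations
    for every x that is not a point.\<close>
  define E where "E z = ennreal (exp_neg (H (ball 0 (real (N (fst z)))) (ins_pt (fst z) (snd z)) -
      H (ball 0 (real (N (fst z)))) (snd z)))" for z
  have E_meas [measurable]: "E \<in> borel_measurable (borel \<Otimes>\<^sub>M config_space)"
  proof -
    have "(\<lambda>z. (\<lambda>(n::nat) z. ennreal (exp_neg (H (ball 0 (real n)) (ins_pt (fst z) (snd z)) - H (ball 0 (real n)) (snd z))))
        (N (fst z)) z) \<in> borel_measurable (borel \<Otimes>\<^sub>M config_space)"
      by (rule measurable_compose_countable) measurable
    then show ?thesis
      by (simp add: E_def[abs_def])
  qed
  have E_eq: "ennreal (exp_neg (local_energy H x \<gamma>)) = E (x, \<gamma>)" if "\<gamma> \<in> ?FE" "x \<notin> points \<gamma>" for x \<gamma>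
    using local_energy_eq[OF H that bounded_borel_ball N_ball] by (simp add: E_def)
  define Q where "Q z = indicator ?FE (snd z) * f z" for z
  have Q_meas [measurable]: "Q \<in> borel_measurable (borel \<Otimes>\<^sub>M config_space)"
    unfolding Q_def by measurable
  define Qn where "Qn n z = indicator (ball 0 (real n)) (fst z) * Q z" for n :: nat and z
  have Qn_meas [measurable]: "Qn n \<in> borel_measurable (borel \<Otimes>\<^sub>M config_space)" for n
    unfolding Qn_def
    by (intro borel_measurable_times_ennreal Q_meas measurable_compose[OF measurable_fst borel_measurable_indicator]) simp
  have Qn_mono: "incseq Qn"
    unfolding incseq_def le_fun_def Qn_def
    by (intro allI impI mult_right_mono) (auto simp: indicator_def)
  have Qn_SUP: "(SUP n. Qn n z) = Q z" for z
  proof (rule antisym)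
    show "(SUP n. Qn n z) \<le> Q z"
      unfolding Qn_def by (intro SUP_least) (auto simp: indicator_def)
    have "Q z = Qn (N (fst z)) z"
      using N_ball by (simp add: Qn_def)
    also have "\<dots> \<le> (SUP n. Qn n z)"
      by (rule SUP_upper) simp
    finally show "Q z \<le> (SUP n. Qn n z)" .
  qed
  have step: "(\<integral>\<^sup>+z. Qn n z \<partial>reduced_campbell \<mu>) = (\<integral>\<^sup>+\<gamma>. \<integral>\<^sup>+x. Qn n (x, \<gamma>) * E (x, \<gamma>) \<partial>lborel \<partial>\<mu>)" for n
  proof -
    let ?\<Lambda> = "ball (0::'a) (real n)"
    have "(\<integral>\<^sup>+z. Qn n z \<partial>reduced_campbell \<mu>) =
        (\<integral>\<^sup>+\<gamma>. \<integral>\<^sup>+x. Qn n (x, \<gamma>) * ennreal (exp_neg (H ?\<Lambda> (ins_pt x \<gamma>) - H ?\<Lambda> \<gamma>)) \<partial>lborel \<partial>\<mu>)"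
    proof (rule gibbs_campbell_local)
      fix x \<gamma> assume "x \<notin> ?\<Lambda> \<or> H ?\<Lambda> \<gamma> = \<infinity>"
      then have "x \<notin> ?\<Lambda> \<or> \<gamma> \<notin> ?FE"
        using bounded_borel_ball[of 0 "real n"] unfolding finite_energy_configs_def by force
      then show "Qn n (x, \<gamma>) = 0"
        by (auto simp: Qn_def Q_def)
    qed simp_all
    \<comment> \<open>The increment in the fixed ball and the one in the ball belonging to x are
      both the local energy, so the integrand no longer depends on n except through
      \<open>Qn\<close>.\<close>
    also have "\<dots> = (\<integral>\<^sup>+\<gamma>. \<integral>\<^sup>+x. Qn n (x, \<gamma>) * E (x, \<gamma>) \<partial>lborel \<partial>\<mu>)"
    proof (rule nn_integral_cong)
      fix \<gamma> assume "\<gamma> \<in> space \<mu>"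
      then have \<gamma>: "\<gamma> \<in> configs" by (simp add: space_law[OF sets_gibbs])
      show "(\<integral>\<^sup>+x. Qn n (x, \<gamma>) * ennreal (exp_neg (H ?\<Lambda> (ins_pt x \<gamma>) - H ?\<Lambda> \<gamma>)) \<partial>lborel) =
          (\<integral>\<^sup>+x. Qn n (x, \<gamma>) * E (x, \<gamma>) \<partial>lborel)"
      proof (rule nn_integral_cong_AE)
        show "AE x in lborel. Qn n (x, \<gamma>) * ennreal (exp_neg (H ?\<Lambda> (ins_pt x \<gamma>) - H ?\<Lambda> \<gamma>)) =
            Qn n (x, \<gamma>) * E (x, \<gamma>)"
          using AE_notin_points[OF \<gamma>]
        proof eventually_elim
          case (elim x)
          show ?case
          proof (cases "x \<in> ?\<Lambda> \<and> \<gamma> \<in> ?FE")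
            case True
            then show ?thesis
              using local_energy_eq[OF H _ elim bounded_borel_ball[of 0 "real n"]] E_eq[OF _ elim] by simp
          next
            case False
            then have "Qn n (x, \<gamma>) = 0"
              by (auto simp: Qn_def Q_def)
            then show ?thesis by simp
          qed
        qed
      qed
    qed
    finally show ?thesis .
  qed
  have cong: "u \<in> borel_measurable (lborel \<Otimes>\<^sub>M \<mu>)" if "u \<in> borel_measurable (borel \<Otimes>\<^sub>M config_space)"
    for u :: "'a \<times> 'a measure \<Rightarrow> ennreal"
    using that by (simp add: measurable_cong_sets[OF sets_pair_measure_cong[OF sets_lborel sets_gibbs] refl])
  have "(\<integral>\<^sup>+(x, \<gamma>). indicator ?FE \<gamma> * f (x, \<gamma>) \<partial>reduced_campbell \<mu>) = (\<integral>\<^sup>+z. (SUP n. Qn n z) \<partial>reduced_campbell \<mu>)"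
    unfolding Qn_SUP by (simp add: Q_def case_prod_beta')
  also have "\<dots> = (SUP n. \<integral>\<^sup>+z. Qn n z \<partial>reduced_campbell \<mu>)"
    by (intro nn_integral_monotone_convergence_SUP Qn_mono measurable_reduced_campbell[OF sets_gibbs] Qn_meas)
  also have "\<dots> = (SUP n. \<integral>\<^sup>+z. Qn n z * E z \<partial>(lborel \<Otimes>\<^sub>M \<mu>))"
    unfolding step
    by (intro SUP_cong refl L.nn_integral_snd[of "\<lambda>z. Qn n z * E z" for n] cong borel_measurable_times_ennreal Qn_meas E_meas)
  also have "\<dots> = (\<integral>\<^sup>+z. (SUP n. Qn n z * E z) \<partial>(lborel \<Otimes>\<^sub>M \<mu>))"
    using Qn_mono
    by (intro nn_integral_monotone_convergence_SUP[symmetric] cong borel_measurable_times_ennreal Qn_meas E_meas)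
      (auto simp: incseq_def le_fun_def intro!: mult_right_mono)
  also have "\<dots> = (\<integral>\<^sup>+z. Q z * E z \<partial>(lborel \<Otimes>\<^sub>M \<mu>))"
    by (simp add: SUP_mult_right_ennreal[symmetric] Qn_SUP)
  also have "\<dots> = (\<integral>\<^sup>+x. \<integral>\<^sup>+\<gamma>. Q (x, \<gamma>) * E (x, \<gamma>) \<partial>\<mu> \<partial>lborel)"
    by (intro \<mu>.nn_integral_fst[symmetric] cong borel_measurable_times_ennreal Q_meas E_meas)
  also have "\<dots> = (\<integral>\<^sup>+x. \<integral>\<^sup>+\<gamma>. f (x, \<gamma>) * ennreal (exp_neg (local_energy H x \<gamma>)) \<partial>\<mu> \<partial>lborel)"
  proof (rule nn_integral_cong_AE)
    have FE: "AE \<gamma> in \<mu>. \<gamma> \<in> ?FE"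
      by (rule AE_finite_energy)
    \<comment> \<open>For a fixed configuration almost no x is a point, but here x is the outer
      variable. Measurability of the incidence relation allows the two quantifiers to be
      exchanged.\<close>
    have "AE x in lborel. AE \<gamma> in \<mu>. x \<notin> points \<gamma>"
    proof (subst L.AE_commute)
      have "{z \<in> space (borel \<Otimes>\<^sub>M config_space). fst z \<notin> points (snd z)} \<in> sets (borel \<Otimes>\<^sub>M config_space)"
        by measurable
      moreover have sets_eq: "sets (lborel \<Otimes>\<^sub>M \<mu>) = sets (borel \<Otimes>\<^sub>M config_space)"
        by (rule sets_pair_measure_cong[OF sets_lborel sets_gibbs])
      ultimately show "{z \<in> space (lborel \<Otimes>\<^sub>M \<mu>). fst z \<notin> points (snd z)} \<in> sets (lborel \<Otimes>\<^sub>M \<mu>)"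
        by (simp only: sets_eq sets_eq_imp_space_eq[OF sets_eq])
      show "AE \<gamma> in \<mu>. AE x in lborel. x \<notin> points \<gamma>"
        by (rule AE_I2, rule AE_notin_points) (simp add: space_law[OF sets_gibbs])
    qed
    then show "AE x in lborel. (\<integral>\<^sup>+\<gamma>. Q (x, \<gamma>) * E (x, \<gamma>) \<partial>\<mu>) =
        (\<integral>\<^sup>+\<gamma>. f (x, \<gamma>) * ennreal (exp_neg (local_energy H x \<gamma>)) \<partial>\<mu>)"
    proof eventually_elim
      case (elim x)
      show ?case
      proof (rule nn_integral_cong_AE)
        \<comment> \<open>On this side the indicator disappears, because \<mu> is carried by the
          finite energy configurations; the reduced Campbell measure need not be.\<close>
        show "AE \<gamma> in \<mu>. Q (x, \<gamma>) * E (x, \<gamma>) = f (x, \<gamma>) * ennreal (exp_neg (local_energy H x \<gamma>))"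
          using elim FE by eventually_elim (simp add: Q_def E_eq)
      qed
    qed
  qed
  finally show ?thesis .
qed

end

theorem proposition2:
  fixes H :: "(real ^ 'd) set \<Rightarrow> (real ^ 'd) measure \<Rightarrow> ereal"
    and \<pi> :: "(real ^ 'd) set \<Rightarrow> (real ^ 'd) measure measure"
    and \<mu> :: "(real ^ 'd) measure measure"
    and f :: "(real ^ 'd) \<times> (real ^ 'd) measure \<Rightarrow> real"
  assumes "CARD('d) > 1"
    and "\<And>\<Lambda>. \<Lambda> \<in> bounded_borel \<Longrightarrow> poisson_on \<Lambda> (\<pi> \<Lambda>)"
    and "energy_family H"
    and "integrable_family \<pi> H"
    and "gibbs_measure \<pi> H \<mu>"
    and "stationary \<mu>"
    and "f \<in> borel_measurable (borel \<Otimes>\<^sub>M config_space)"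
    and "bounded (f ` (UNIV \<times> configs))"
    and "\<And>x \<gamma>. \<gamma> \<in> configs \<Longrightarrow> 0 \<le> f (x, \<gamma>)"
  shows "(\<integral>\<^sup>+(x, \<gamma>). indicator (finite_energy_configs H) \<gamma> * ennreal (f (x, \<gamma>))
            \<partial>reduced_campbell \<mu>) =
         (\<integral>\<^sup>+x. (\<integral>\<^sup>+\<gamma>. ennreal (f (x, \<gamma>) * exp_neg (local_energy H x \<gamma>)) \<partial>\<mu>) \<partial>lborel)"
proof -
  have "(\<lambda>z. ennreal (f z)) \<in> borel_measurable (borel \<Otimes>\<^sub>M config_space)"
    using assms(7) by simp
  from gibbs_campbell[OF assms(3,2,5) this] show ?thesis
    by (simp add: ennreal_mult'')
qed

end
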